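(* Consider the OSA scheme with equiprobable rectangular $M_I\times M_Q$ QAM over Rayleigh fading ($|h|^2$ has density $e^{-x}$, $x\ge0$). Let $P_{\rm pk},Q_{\rm pk}>0$ and suppose that the transmit power is $P_0=\min\{P_{\rm pk},Q_{\rm pk}/|g|^2\}$, where $|g|^2$ is exponentially distributed with unit mean. Let $\mathrm{SEP}$ be the symbol error probability of the optimal (maximum a posteriori) detector averaged over $h$ and $g$, and let $\mathrm{SEP}(P_{\rm pk})$ be the one averaged over $h$ when the power is fixed at $P_0=P_{\rm pk}$. Then $$\begin{aligned}\mathrm{SEP}\le\Big(1-e^{-\frac{Q_{\rm pk}}{P_{\rm pk}}}\Big)\mathrm{SEP}(P_{\rm pk})+\Big(2-\frac1{M_I}-\frac1{M_Q}\Big)\Bigg\{&\Pr\{\mathcal H_0|\hat{\mathcal H}_0\}\Big[e^{-\frac{Q_{\rm pk}}{P_{\rm pk}}}-2\sqrt{\psi_0\pi}\,e^{\psi_0}Q\Big(\sqrt{2\big(\tfrac{Q_{\rm pk}}{P_{\rm pk}}+\psi_0\big)}\Big)\Big]\\ +&\Pr\{\mathcal H_1|\hat{\mathcal H}_0\}\sum_{l=1}^p\lambda_l\Big[e^{-\frac{Q_{\rm pk}}{P_{\rm pk}}}-2\sqrt{\psi_{1,l}\pi}\,e^{\psi_{1,l}}Q\Big(\sqrt{2\big(\tfrac{Q_{\rm pk}}{P_{\rm pk}}+\psi_{1,l}\big)}\Big)\Big]\Bigg\},\end{aligned}$$ where $$\psi_0=\frac{3Q_{\rm pk}}{2(M_I^2+M_Q^2-2)\sigma_n^2},\qquad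 \psi_{1,l}=\frac{3Q_{\rm pk}}{2(M_I^2+M_Q^2-2)(\sigma_l^2+\sigma_n^2)},\qquad Q(x)=\int_x^\infty\frac1{\sqrt{2\pi}}e^{-t^2/2}\,dt.$$ Moreover, equality holds for PAM, i.e. when $M_I=M$ and $M_Q=1$.
   Context: Setting (cognitive radio with imperfect sensing). The true channel state is $\mathcal H_0$ (primary user idle) or $\mathcal H_1$ (primary user active), with given prior probabilities. The sensing decision is $\hat{\mathcal H}_0$ (idle) or $\hat{\mathcal H}_1$ (busy), with $P_{\rm d}=\Pr\{\hat{\mathcal H}_1|\mathcal H_1\}$ and $P_{\rm f}=\Pr\{\hat{\mathcal H}_1|\mathcal H_0\}$. The posteriors $\Pr\{\mathcal H_j|\hat{\mathcal H}_0\}$ follow by Bayes' rule; assume $\Pr\{\hat{\mathcal H}_0\}>0$. In the opportunistic spectrum access (OSA) scheme the secondary user transmits only under decision $\hat{\mathcal H}_0$, with power $P_0$, and error probabilities are conditional on $\hat{\mathcal H}_0$. $P_{\rm pk}$ is a peak transmit power limit, $Q_{\rm pk}$ a peak interference limit, and $g$ the fading coefficient between secondary transmitter and primary receiver (known to the secondary transmitter). Constellation. $M_I,M_Q\ge1$ are integers with $M=M_IM_Q\ge 2$. The transmitted symbol is uniform on the points $s_{n,q}=s_n+js_q$ with $$s_n=(2n+1-M_I)\tfrac{d_{min,0}}{2}\ (0\le n\le M_I-1),\qquad s_q=(2q+1-M_Q)\tfrac{d_{min,0}}{2}\ (0\le q\le M_Q-1),$$ $$d_{min,0}=\sqrt{\tfrac{12P_0}{M_I^2+M_Q^2-2}}.$$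 Channel. The received signal is $y=hs+n$ under $\mathcal H_0$ and $y=hs+n+w$ under $\mathcal H_1$. The noise $n$ has density $\frac{1}{2\pi\sigma_n^2}e^{-|n|^2/(2\sigma_n^2)}$ on $\mathbb C$ ($\sigma_n^2>0$). The primary interference $w$ has Gaussian mixture density $\sum_{l=1}^p\frac{\lambda_l}{2\pi\sigma_l^2}e^{-|w|^2/(2\sigma_l^2)}$, with $\sigma_l^2>0$, $\lambda_l\ge0$, $\sum_l\lambda_l=1$. The variables $n$ and $w$ are independent of each other. Given the sensing decision and the true state, they are also independent of the transmitted symbol. The fading coefficients $h$ and $g$ are independent of each other and of the channel state, sensing decision, noise and interference. The constellation index $(n,q)$ of the transmitted symbol is independent of $h$ and $g$. Detector. Knowing $\hat{\mathcal H}_0$, $h$, the constellation in use (i.e. the power $P_0$) and $y$, the receiver outputs a constellation point maximizing $\Pr\{\mathcal H_0|\hat{\mathcal H}_0\}f(y|s,h,\hat{\mathcal H}_0,\mathcal H_0)+\Pr\{\mathcal H_1|\hat{\mathcal H}_0\}f(y|s,h,\hat{\mathcal H}_0,\mathcal H_1)$, where $f(y|s,h,\hat{\mathcal H}_0,\mathcal H_j)$ is the conditional density of $y$. The symbol error probability is the probability, given $\hat{\mathcal H}_0$, that the output differs from the transmitted symbol, averaged over symbol and true state. *)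

theory Defs
  imports "HOL-Probability.Probability"
begin

definition preimage_events :: "'a measure \<Rightarrow> 'b measure \<Rightarrow> ('a \<Rightarrow> 'b) \<Rightarrow> 'a set set" where
  "preimage_events M N X = {X -` A \<inter> space M | A. A \<in> sets N}"

(* Mutual independence as in prob_space.indep_vars, which requires a common value type. *)
definition indep_triple ::
  "'a measure \<Rightarrow> 'b measure \<Rightarrow> ('a \<Rightarrow> 'b) \<Rightarrow> 'c measure \<Rightarrow> ('a \<Rightarrow> 'c) \<Rightarrow> 'd measure \<Rightarrow> ('a \<Rightarrow> 'd) \<Rightarrow> bool" where
  "indep_triple M N1 X1 N2 X2 N3 X3 \<longleftrightarrow>
     X1 \<in> measurable M N1 \<and> X2 \<in> measurable M N2 \<and> X3 \<in> measurable M N3 \<and>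
     prob_space.indep_sets M
       (nth [preimage_events M N1 X1, preimage_events M N2 X2, preimage_events M N3 X3]) {..<3}"

(* Circularly symmetric complex Gaussian; v is the variance per real dimension. *)
definition cgauss_density :: "real \<Rightarrow> complex \<Rightarrow> real" where
  "cgauss_density v z = exp (- (cmod z)\<^sup>2 / (2 * v)) / (2 * pi * v)"

definition gauss_mixture_density :: "nat \<Rightarrow> (nat \<Rightarrow> real) \<Rightarrow> (nat \<Rightarrow> real) \<Rightarrow> complex \<Rightarrow> real" where
  "gauss_mixture_density p c \<sigma> z = (\<Sum>l=1..p. c l * cgauss_density ((\<sigma> l)\<^sup>2) z)"

definition gaussian_Q :: "real \<Rightarrow> real" where
  "gaussian_Q x = (LINT t:{x..}|lborel. 1 / sqrt (2 * pi) * exp (- t\<^sup>2 / 2))"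

definition qam_dmin :: "nat \<Rightarrow> nat \<Rightarrow> real \<Rightarrow> real" where
  "qam_dmin M_I M_Q P = sqrt (12 * P / ((real M_I)\<^sup>2 + (real M_Q)\<^sup>2 - 2))"

definition qam_point :: "nat \<Rightarrow> nat \<Rightarrow> real \<Rightarrow> nat \<times> nat \<Rightarrow> complex" where
  "qam_point M_I M_Q P i =
     Complex ((2 * real (fst i) + 1 - real M_I) * (qam_dmin M_I M_Q P / 2))
             ((2 * real (snd i) + 1 - real M_Q) * (qam_dmin M_I M_Q P / 2))"

definition qam_constellation :: "nat \<Rightarrow> nat \<Rightarrow> real \<Rightarrow> complex set" where
  "qam_constellation M_I M_Q P = qam_point M_I M_Q P ` ({..<M_I} \<times> {..<M_Q})"

(* active: the true state is H_1; busy: the sensing decision is H_1.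
   symbol_index is the pair (n,q). The last six fields are deterministic parameters;
   the mixture components are l = 1..mix_number. *)
record 'a osa_system =
  prob_of :: "'a measure"
  active :: "'a \<Rightarrow> bool"
  busy :: "'a \<Rightarrow> bool"
  fading_h :: "'a \<Rightarrow> complex"
  fading_g :: "'a \<Rightarrow> complex"
  symbol_index :: "'a \<Rightarrow> nat \<times> nat"
  noise :: "'a \<Rightarrow> complex"
  interference :: "'a \<Rightarrow> complex"
  size_I :: nat
  size_Q :: nat
  sigma_noise :: real
  mix_number :: nat
  mix_weight :: "nat \<Rightarrow> real"
  mix_sigma :: "nat \<Rightarrow> real"

definition posterior :: "'a osa_system \<Rightarrow> bool \<Rightarrow> real" where
  "posterior S j = \<P>(\<omega> in prob_of S. active S \<omega> = j \<bar> \<not> busy S \<omega>)"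

(* The probability measure conditioned on an idle decision and on the true state j. *)
definition given_idle_state :: "'a osa_system \<Rightarrow> bool \<Rightarrow> 'a measure" where
  "given_idle_state S j =
     uniform_measure (prob_of S) {\<omega> \<in> space (prob_of S). \<not> busy S \<omega> \<and> active S \<omega> = j}"

definition idle_state_possible :: "'a osa_system \<Rightarrow> bool \<Rightarrow> bool" where
  "idle_state_possible S j \<longleftrightarrow> \<P>(\<omega> in prob_of S. \<not> busy S \<omega> \<and> active S \<omega> = j) > 0"

locale osa_model = prob_space "prob_of S" for S :: "'a osa_system" +
  assumes size_I_pos: "1 \<le> size_I S"
    and size_Q_pos: "1 \<le> size_Q S"
    and size_ge_2: "2 \<le> size_I S * size_Q S"
    and noise_var_pos: "0 < (sigma_noise S)\<^sup>2"
    and mix_var_pos: "\<And>l. l \<in> {1..mix_number S} \<Longrightarrow> 0 < (mix_sigma S l)\<^sup>2"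
    and mix_weight_nonneg: "\<And>l. l \<in> {1..mix_number S} \<Longrightarrow> 0 \<le> mix_weight S l"
    and mix_weight_sum: "(\<Sum>l=1..mix_number S. mix_weight S l) = 1"
    and idle_pos: "\<P>(\<omega> in prob_of S. \<not> busy S \<omega>) > 0"
    and fading_indep:
      "indep_triple (prob_of S) borel (fading_h S) borel (fading_g S)
         (count_space UNIV \<Otimes>\<^sub>M count_space UNIV \<Otimes>\<^sub>M count_space UNIV \<Otimes>\<^sub>M borel \<Otimes>\<^sub>M borel)
         (\<lambda>\<omega>. (active S \<omega>, busy S \<omega>, symbol_index S \<omega>, noise S \<omega>, interference S \<omega>))"
    and transmission_indep:
      "\<And>j. idle_state_possible S j \<Longrightarrow>
         indep_triple (given_idle_state S j)
           (count_space UNIV) (symbol_index S) borel (noise S) borel (interference S)"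
    and symbol_index_uniform:
      "\<And>j. idle_state_possible S j \<Longrightarrow>
         distr (given_idle_state S j) (count_space UNIV) (symbol_index S) =
           measure_pmf (pmf_of_set ({..<size_I S} \<times> {..<size_Q S}))"
    and noise_density:
      "\<And>j. idle_state_possible S j \<Longrightarrow>
         distributed (given_idle_state S j) lborel (noise S)
           (\<lambda>z. ennreal (cgauss_density ((sigma_noise S)\<^sup>2) z))"
    and interference_density:
      "\<And>j. idle_state_possible S j \<Longrightarrow>
         distributed (given_idle_state S j) lborel (interference S)
           (\<lambda>z. ennreal (gauss_mixture_density (mix_number S) (mix_weight S) (mix_sigma S) z))"

(* Bayes' rule: the posteriors expressed through the prior, P_d and P_f. *)
lemma (in osa_model) posterior_bayes:
  fixes \<pi>\<^sub>0 \<pi>\<^sub>1 P\<^sub>d P\<^sub>f :: real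
  defines "\<pi>\<^sub>0 \<equiv> \<P>(\<omega> in prob_of S. \<not> active S \<omega>)"
    and "\<pi>\<^sub>1 \<equiv> \<P>(\<omega> in prob_of S. active S \<omega>)"
    and "P\<^sub>d \<equiv> \<P>(\<omega> in prob_of S. busy S \<omega> \<bar> active S \<omega>)"
    and "P\<^sub>f \<equiv> \<P>(\<omega> in prob_of S. busy S \<omega> \<bar> \<not> active S \<omega>)"
  shows "posterior S False = \<pi>\<^sub>0 * (1 - P\<^sub>f) / (\<pi>\<^sub>0 * (1 - P\<^sub>f) + \<pi>\<^sub>1 * (1 - P\<^sub>d))"
    and "posterior S True = \<pi>\<^sub>1 * (1 - P\<^sub>d) / (\<pi>\<^sub>0 * (1 - P\<^sub>f) + \<pi>\<^sub>1 * (1 - P\<^sub>d))"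
proof -
  let ?X = "\<lambda>\<omega>. (active S \<omega>, busy S \<omega>, symbol_index S \<omega>, noise S \<omega>, interference S \<omega>)"
  have X: "?X \<in> measurable (prob_of S)
      (count_space UNIV \<Otimes>\<^sub>M count_space UNIV \<Otimes>\<^sub>M count_space UNIV \<Otimes>\<^sub>M borel \<Otimes>\<^sub>M borel)"
    using fading_indep by (simp add: indep_triple_def)
  have [measurable]: "Measurable.pred (prob_of S) (active S)"
    using measurable_compose[OF X measurable_fst] by simp
  have [measurable]: "Measurable.pred (prob_of S) (busy S)"
    using measurable_compose[OF measurable_compose[OF X measurable_snd] measurable_fst] by simp
  define a where "a = \<P>(\<omega> in prob_of S. busy S \<omega> \<and> active S \<omega>)"
  define b where "b = \<P>(\<omega> in prob_of S. busy S \<omega> \<and> \<not> active S \<omega>)"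
  define c where "c = \<P>(\<omega> in prob_of S. active S \<omega> \<and> \<not> busy S \<omega>)"
  define d where "d = \<P>(\<omega> in prob_of S. \<not> active S \<omega> \<and> \<not> busy S \<omega>)"
  have p1: "\<pi>\<^sub>1 = a + c" unfolding \<pi>\<^sub>1_def a_def c_def
    by (subst finite_measure_Union[symmetric]) (auto intro!: arg_cong[where f=prob])
  have p0: "\<pi>\<^sub>0 = b + d" unfolding \<pi>\<^sub>0_def b_def d_def
    by (subst finite_measure_Union[symmetric]) (auto intro!: arg_cong[where f=prob])
  have idle: "\<P>(\<omega> in prob_of S. \<not> busy S \<omega>) = d + c" unfolding c_def d_def
    by (subst finite_measure_Union[symmetric]) (auto intro!: arg_cong[where f=prob])
  have nn: "0 \<le> a" "0 \<le> b" "0 \<le> c" "0 \<le> d"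
    by (simp_all add: a_def b_def c_def d_def)
  have ratio: "(x + y) * (1 - x / (x + y)) = y" if "0 \<le> x" "0 \<le> y" for x y :: real
    using that by (cases "x + y = 0") (simp_all add: right_diff_distrib)
  have "P\<^sub>d = a / \<pi>\<^sub>1" "P\<^sub>f = b / \<pi>\<^sub>0"
    by (simp_all add: P\<^sub>d_def P\<^sub>f_def \<pi>\<^sub>1_def \<pi>\<^sub>0_def cond_prob_def a_def b_def)
  then have cd: "\<pi>\<^sub>1 * (1 - P\<^sub>d) = c" "\<pi>\<^sub>0 * (1 - P\<^sub>f) = d"
    using nn by (simp_all add: p0 p1 ratio)
  show "posterior S False = \<pi>\<^sub>0 * (1 - P\<^sub>f) / (\<pi>\<^sub>0 * (1 - P\<^sub>f) + \<pi>\<^sub>1 * (1 - P\<^sub>d))"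
    unfolding cd by (simp add: posterior_def cond_prob_def idle d_def[symmetric])
  show "posterior S True = \<pi>\<^sub>1 * (1 - P\<^sub>d) / (\<pi>\<^sub>0 * (1 - P\<^sub>f) + \<pi>\<^sub>1 * (1 - P\<^sub>d))"
    unfolding cd by (simp add: posterior_def cond_prob_def idle c_def[symmetric])
qed

(* In the following, the transmit power P may depend on the outcome (through g). *)

definition tx_symbol :: "'a osa_system \<Rightarrow> ('a \<Rightarrow> real) \<Rightarrow> 'a \<Rightarrow> complex" where
  "tx_symbol S P \<omega> = qam_point (size_I S) (size_Q S) (P \<omega>) (symbol_index S \<omega>)"

definition rx_signal :: "'a osa_system \<Rightarrow> ('a \<Rightarrow> real) \<Rightarrow> 'a \<Rightarrow> complex" where
  "rx_signal S P \<omega> = fading_h S \<omega> * tx_symbol S P \<omega> + noise S \<omega> +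
     (if active S \<omega> then interference S \<omega> else 0)"

(* f y s h is a version of the density of the received signal y conditional on
   (symbol, h) = (s, h), an idle decision and the true state j. *)
definition cond_density_rx ::
  "'a osa_system \<Rightarrow> ('a \<Rightarrow> real) \<Rightarrow> bool \<Rightarrow> (complex \<Rightarrow> complex \<Rightarrow> complex \<Rightarrow> real) \<Rightarrow> bool" where
  "cond_density_rx S P j f \<longleftrightarrow>
     distributed (given_idle_state S j)
       (distr (given_idle_state S j) (borel \<Otimes>\<^sub>M borel) (\<lambda>\<omega>. (tx_symbol S P \<omega>, fading_h S \<omega>)) \<Otimes>\<^sub>M lborel)
       (\<lambda>\<omega>. ((tx_symbol S P \<omega>, fading_h S \<omega>), rx_signal S P \<omega>))
       (\<lambda>((s, h), y). ennreal (f y s h))"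

(* The detector maps h, the transmit power and y to a constellation point. Conditional
   densities are unique only almost everywhere and maximizers may be tied, so a detector is
   any measurable selection of maximizers for some version of the densities. *)
definition MAP_detector ::
  "'a osa_system \<Rightarrow> ('a \<Rightarrow> real) \<Rightarrow> (complex \<Rightarrow> real \<Rightarrow> complex \<Rightarrow> complex) \<Rightarrow> bool" where
  "MAP_detector S P detect \<longleftrightarrow>
     (\<lambda>(h, x, y). detect h x y) \<in> borel_measurable (borel \<Otimes>\<^sub>M borel \<Otimes>\<^sub>M borel) \<and>
     (\<exists>f :: bool \<Rightarrow> complex \<Rightarrow> complex \<Rightarrow> complex \<Rightarrow> real.
        (\<forall>j. idle_state_possible S j \<longrightarrow> cond_density_rx S P j (f j)) \<and>
        (\<forall>h x y. x > 0 \<longrightarrow>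
           is_arg_max (\<lambda>s. posterior S False * f False y s h + posterior S True * f True y s h)
             (\<lambda>s. s \<in> qam_constellation (size_I S) (size_Q S) x) (detect h x y)))"

definition symbol_error_prob ::
  "'a osa_system \<Rightarrow> ('a \<Rightarrow> real) \<Rightarrow> (complex \<Rightarrow> real \<Rightarrow> complex \<Rightarrow> complex) \<Rightarrow> real" where
  "symbol_error_prob S P detect =
     \<P>(\<omega> in prob_of S. detect (fading_h S \<omega>) (P \<omega>) (rx_signal S P \<omega>) \<noteq> tx_symbol S P \<omega> \<bar> \<not> busy S \<omega>)"

(* For g = 0 the interference limit is void, whereas Q_pk / 0 = 0 in HOL. *)
definition limited_power :: "'a osa_system \<Rightarrow> real \<Rightarrow> real \<Rightarrow> 'a \<Rightarrow> real" where
  "limited_power S P_pk Q_pk \<omega> =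
     (if fading_g S \<omega> = 0 then P_pk else min P_pk (Q_pk / (cmod (fading_g S \<omega>))\<^sup>2))"

end

theory Submission
  imports Defs "HOL-Real_Asymp.Real_Asymp"
begin

text \<open>Given the true state, the total noise has a mixture of circular Gaussian densities, each strictly
  decreasing in the modulus, so whatever version of the densities is used the MAP detector is almost
  surely a nearest-point detector. By rotation invariance an in-phase (quadrature) decision error then
  has probability \<open>2 (1 - 1/M_I) Q\<close> (\<open>2 (1 - 1/M_Q) Q\<close>), averaged over the symbol, and the union bound,
  which is exact when \<open>M_Q = 1\<close>, gives the factor \<open>2 - 1/M_I - 1/M_Q\<close>. Averaging \<open>Q\<close> over the Rayleigh
  fading yields \<open>(1 - sqrt (\<psi> / (x + \<psi>))) / 2\<close> at \<open>x = |g|\<^sup>2\<close>, whose integral over \<open>x > Q_pk / P_pk\<close> is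
  elementary up to \<open>Q\<close>. For \<open>x \<le> Q_pk / P_pk\<close> the power is \<open>P_pk\<close>, and \<open>g\<close> is independent of all other variables.\<close>

subsection \<open>Gaussian densities on the complex plane\<close>

text \<open>Conditional densities are fixed only up to null sets of the joint law of symbol and
  \<open>h\<close>, and under the adaptive power the symbol itself varies with \<open>g\<close>.
  Almost-everywhere statements are therefore carried over to \<open>g\<close>, \<open>h\<close>, the
  symbol index and the noise, which are independent given the state; every index has positive
  probability, so none is lost in a null set. The error probability then becomes an integral of a
  kernel in the fading value and the power that no longer mentions a detector. This is what makes
  the two detectors of the theorem comparable, although they belong to different power rules.
  Probabilities are kept as \<open>ennreal\<close> integrals, so that Fubini and linearity need no
  integrability; the price is a nonnegativity proof whenever a closed form is turned into a real
  number. A state that is impossible after an idle decision has no conditional law worth speaking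
  of; it drops out because its posterior is zero.\<close>

lemma lborel_complex: "lborel = distr (lborel \<Otimes>\<^sub>M lborel) borel (\<lambda>(x, y). Complex x y)"
proof (rule lborel_eqI)
  have [measurable]: "(\<lambda>(x, y). Complex x y) \<in> borel_measurable (lborel \<Otimes>\<^sub>M lborel)"
    by (simp add: complex_eq_iff Complex_eq split_beta')
  fix l u :: complex
  assume le: "\<And>b. b \<in> Basis \<Longrightarrow> l \<bullet> b \<le> u \<bullet> b"
  have "(\<lambda>(x, y). Complex x y) -` box l u \<inter> space (lborel \<Otimes>\<^sub>M lborel) = {Re l<..<Re u} \<times> {Im l<..<Im u}"
    by (auto simp: box_def Basis_complex_def space_pair_measure)
  moreover have "Re l \<le> Re u" "Im l \<le> Im u"
    using le[of 1] le[of \<i>] by (auto simp: Basis_complex_def)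
  ultimately show "emeasure (distr (lborel \<Otimes>\<^sub>M lborel) borel (\<lambda>(x, y). Complex x y)) (box l u) =
      ennreal (\<Prod>b\<in>Basis. (u - l) \<bullet> b)"
    by (simp add: emeasure_distr lborel.emeasure_pair_measure_Times Basis_complex_def ennreal_mult)
qed simp

lemma measurable_Complex [measurable]:
  assumes "f \<in> borel_measurable M" "g \<in> borel_measurable M"
  shows "(\<lambda>x. Complex (f x) (g x)) \<in> borel_measurable M"
  using assms by (simp add: Complex_eq)

lemma nn_integral_complex:
  fixes F :: "complex \<Rightarrow> ennreal"
  assumes [measurable]: "F \<in> borel_measurable borel"
  shows "(\<integral>\<^sup>+z. F z \<partial>lborel) = (\<integral>\<^sup>+x. \<integral>\<^sup>+y. F (Complex x y) \<partial>lborel \<partial>lborel)"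
  by (subst lborel_complex) (simp add: nn_integral_distr split_beta' lborel.nn_integral_fst[symmetric])

text \<open>For \<alpha> \<noteq> 0 the rotation factors into two shears with scalings: first
  \<open>x\<close> is substituted at fixed \<open>y\<close>, then \<open>y\<close> at fixed
  \<open>x\<close>, and the Jacobians \<open>1 / \<alpha>\<close> and \<open>\<alpha>\<close> cancel
  in absolute value. For \<alpha> = 0 it is a quarter turn, which swaps the coordinates up to
  signs.\<close>

lemma nn_integral_complex_rotate:
  fixes F :: "complex \<Rightarrow> ennreal"
  assumes F[measurable]: "F \<in> borel_measurable borel" and c: "cmod c = 1"
  shows "(\<integral>\<^sup>+z. F (c * z) \<partial>lborel) = (\<integral>\<^sup>+z. F z \<partial>lborel)"
proof -
  define \<alpha> \<beta> where "\<alpha> = Re c" and "\<beta> = Im c"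
  have one: "\<alpha>\<^sup>2 + \<beta>\<^sup>2 = 1"
    using c by (simp add: \<alpha>_def \<beta>_def cmod_def)
  have mult: "c * Complex x y = Complex (\<alpha> * x - \<beta> * y) (\<beta> * x + \<alpha> * y)" for x y
    by (simp add: complex_eq_iff \<alpha>_def \<beta>_def)
  have "(\<integral>\<^sup>+z. F (c * z) \<partial>lborel) =
      (\<integral>\<^sup>+x. \<integral>\<^sup>+y. F (Complex (\<alpha> * x - \<beta> * y) (\<beta> * x + \<alpha> * y)) \<partial>lborel \<partial>lborel)"
    by (subst nn_integral_complex) (simp_all add: mult)
  also have "\<dots> = (\<integral>\<^sup>+x. \<integral>\<^sup>+y. F (Complex x y) \<partial>lborel \<partial>lborel)"
  proof (cases "\<alpha> = 0")
    case True
    with one have sq: "\<beta>\<^sup>2 = 1"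
      by simp
    then have \<beta>: "\<beta> \<noteq> 0" "\<bar>\<beta>\<bar> = 1" "\<beta> * \<beta> = 1"
      using abs_square_eq_1[of \<beta>] by (auto simp: power2_eq_square)
    have "(\<integral>\<^sup>+y. F (Complex (- \<beta> * y) x) \<partial>lborel) = (\<integral>\<^sup>+y. F (Complex y x) \<partial>lborel)" for x
      using \<beta> by (subst nn_integral_real_affine[where c="-\<beta>" and t=0]) (simp_all add: mult.assoc[symmetric])
    then have "(\<integral>\<^sup>+x. \<integral>\<^sup>+y. F (Complex (- (\<beta> * y)) (\<beta> * x)) \<partial>lborel \<partial>lborel) =
        (\<integral>\<^sup>+x. \<integral>\<^sup>+y. F (Complex y (\<beta> * x)) \<partial>lborel \<partial>lborel)"
      by simp
    also have "\<dots> = (\<integral>\<^sup>+x. \<integral>\<^sup>+y. F (Complex y x) \<partial>lborel \<partial>lborel)"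
      using \<beta> by (subst nn_integral_real_affine[where c="\<beta>" and t=0]) (simp_all add: mult.assoc[symmetric])
    also have "\<dots> = (\<integral>\<^sup>+x. \<integral>\<^sup>+y. F (Complex x y) \<partial>lborel \<partial>lborel)"
      by (rule lborel_pair.Fubini'[symmetric]) simp
    finally show ?thesis
      using True by simp
  next
    case False
    \<comment> \<open>The substitution for \<open>x\<close> is chosen to make the first coordinate
      \<open>x\<close> itself; that the second becomes \<open>(y + \<beta> * x) / \<alpha>\<close>
      uses that \<open>c\<close> lies on the unit circle.\<close>
    have eq: "\<alpha> * (\<beta> * y / \<alpha> + 1 / \<alpha> * x) - \<beta> * y = x"
      "\<beta> * (\<beta> * y / \<alpha> + 1 / \<alpha> * x) + \<alpha> * y = (y + \<beta> * x) / \<alpha>" for x y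
      subgoal using False by (simp add: field_simps)
    proof -
      have "\<beta> * (\<beta> * y / \<alpha> + 1 / \<alpha> * x) + \<alpha> * y = ((\<alpha>\<^sup>2 + \<beta>\<^sup>2) * y + \<beta> * x) / \<alpha>"
        using False by (simp add: field_simps power2_eq_square)
      then show "\<beta> * (\<beta> * y / \<alpha> + 1 / \<alpha> * x) + \<alpha> * y = (y + \<beta> * x) / \<alpha>"
        by (simp add: one)
    qed
    have "(\<integral>\<^sup>+x. \<integral>\<^sup>+y. F (Complex (\<alpha> * x - \<beta> * y) (\<beta> * x + \<alpha> * y)) \<partial>lborel \<partial>lborel) =
        (\<integral>\<^sup>+y. \<integral>\<^sup>+x. F (Complex (\<alpha> * x - \<beta> * y) (\<beta> * x + \<alpha> * y)) \<partial>lborel \<partial>lborel)"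
      by (rule lborel_pair.Fubini'[symmetric]) simp
    also have "\<dots> = (\<integral>\<^sup>+y. ennreal \<bar>1 / \<alpha>\<bar> * \<integral>\<^sup>+x. F (Complex x ((y + \<beta> * x) / \<alpha>)) \<partial>lborel \<partial>lborel)"
    proof (rule nn_integral_cong)
      fix y
      show "(\<integral>\<^sup>+x. F (Complex (\<alpha> * x - \<beta> * y) (\<beta> * x + \<alpha> * y)) \<partial>lborel) =
          ennreal \<bar>1 / \<alpha>\<bar> * \<integral>\<^sup>+x. F (Complex x ((y + \<beta> * x) / \<alpha>)) \<partial>lborel"
        using False
        by (subst nn_integral_real_affine[where c="1 / \<alpha>" and t="\<beta> * y / \<alpha>"]) (simp_all only: eq, simp_all)
    qed
    also have "\<dots> = ennreal \<bar>1 / \<alpha>\<bar> * \<integral>\<^sup>+y. \<integral>\<^sup>+x. F (Complex x ((y + \<beta> * x) / \<alpha>)) \<partial>lborel \<partial>lborel"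
      by (rule nn_integral_cmult) simp
    also have "\<dots> = ennreal \<bar>1 / \<alpha>\<bar> * \<integral>\<^sup>+x. \<integral>\<^sup>+y. F (Complex x ((y + \<beta> * x) / \<alpha>)) \<partial>lborel \<partial>lborel"
      by (subst lborel_pair.Fubini') simp_all
    also have "\<dots> = ennreal \<bar>1 / \<alpha>\<bar> * \<integral>\<^sup>+x. ennreal \<bar>\<alpha>\<bar> * \<integral>\<^sup>+y. F (Complex x y) \<partial>lborel \<partial>lborel"
    proof (intro arg_cong2[where f="(*)"] refl nn_integral_cong)
      fix x
      show "(\<integral>\<^sup>+y. F (Complex x ((y + \<beta> * x) / \<alpha>)) \<partial>lborel) = ennreal \<bar>\<alpha>\<bar> * \<integral>\<^sup>+y. F (Complex x y) \<partial>lborel"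
        using False by (subst nn_integral_real_affine[where c="\<alpha>" and t="- \<beta> * x"]) simp_all
    qed
    also have "\<dots> = \<integral>\<^sup>+x. \<integral>\<^sup>+y. F (Complex x y) \<partial>lborel \<partial>lborel"
      using False by (subst nn_integral_cmult)
        (simp_all add: mult.assoc[symmetric] ennreal_mult[symmetric] flip: abs_mult)
    finally show ?thesis .
  qed
  also have "\<dots> = (\<integral>\<^sup>+z. F z \<partial>lborel)"
    by (rule nn_integral_complex[symmetric]) simp
  finally show ?thesis .
qed

lemma AE_lborel_translate:
  fixes c :: "'a::euclidean_space"
  assumes "AE z in lborel. P z"
  shows "AE z in lborel. P (c + z)"
  using assms AE_distrD[of "(+) c" lborel borel P] unfolding lborel_distr_plus by simp

text \<open>The exceptional set is a line, since \<open>Re (c * z)\<close> is the inner product of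
  \<open>z\<close> with \<open>cnj c\<close>. It serves to discard the decision boundaries.\<close>

lemma AE_lborel_Re_neq:
  assumes "c \<noteq> 0"
  shows "AE z in lborel. Re (c * z) \<noteq> t"
proof -
  have eq: "{z. Re (c * z) = t} = {z. cnj c \<bullet> z = t}"
    by (simp add: inner_complex_def)
  have "negligible {z. Re (c * z) = t}"
    unfolding eq using assms by (intro negligible_hyperplane) simp
  moreover have "{z. Re (c * z) = t} \<in> sets borel"
    by simp
  ultimately have "{z. Re (c * z) = t} \<in> null_sets lborel"
    by (simp add: negligible_iff_null_sets null_sets_completion_iff)
  then show ?thesis
    by (rule AE_I') auto
qed

lemma cgauss_density_Complex:
  assumes "0 < v"
  shows "cgauss_density v (Complex x y) = normal_density 0 (sqrt v) x * normal_density 0 (sqrt v) y"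
  using assms by (simp add: cgauss_density_def normal_density_def cmod_def real_sqrt_mult field_simps exp_add[symmetric])

lemma measurable_cgauss_density [measurable]: "cgauss_density v \<in> borel_measurable borel"
  unfolding cgauss_density_def by measurable

lemma cgauss_density_pos: "0 < v \<Longrightarrow> 0 < cgauss_density v z"
  by (simp add: cgauss_density_def)

lemma nn_integral_normal_density: "0 < \<sigma> \<Longrightarrow> (\<integral>\<^sup>+x. ennreal (normal_density \<mu> \<sigma> x) \<partial>lborel) = 1"
  by (simp add: nn_integral_eq_integral normal_density_nonneg)

lemma gaussian_Q_eq_normal: "gaussian_Q x = (LINT t:{x..}|lborel. std_normal_density t)"
  by (simp add: gaussian_Q_def normal_density_def)

lemma nn_integral_gaussian_tail:
  "(\<integral>\<^sup>+t. ennreal (std_normal_density t) * indicator {x<..} t \<partial>lborel) = ennreal (gaussian_Q x)"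
proof -
  have "(\<integral>\<^sup>+t. ennreal (std_normal_density t) * indicator {x<..} t \<partial>lborel) =
      (\<integral>\<^sup>+t. ennreal (indicator {x..} t * std_normal_density t) \<partial>lborel)"
    using AE_lborel_singleton[of x] by (intro nn_integral_cong_AE) (auto split: split_indicator)
  also have "\<dots> = ennreal (\<integral>t. indicator {x..} t * std_normal_density t \<partial>lborel)"
    by (intro nn_integral_eq_integral integrable_real_mult_indicator[where A="{x..}", simplified mult.commute])
      (auto simp: mult.commute intro!: integrable_real_mult_indicator)
  finally show ?thesis
    by (simp add: gaussian_Q_eq_normal set_lebesgue_integral_def)
qed

lemma nn_integral_normal_tail:
  assumes "0 < \<sigma>"
  shows "(\<integral>\<^sup>+x. ennreal (normal_density 0 \<sigma> x) * indicator {t<..} x \<partial>lborel) = ennreal (gaussian_Q (t / \<sigma>))"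
proof -
  have "ennreal \<bar>\<sigma>\<bar> * (ennreal (normal_density 0 \<sigma> (0 + \<sigma> * x)) * indicator {t<..} (0 + \<sigma> * x)) =
      ennreal (std_normal_density x) * indicator {t / \<sigma> <..} x" for x
    using assms
    by (auto simp: normal_density_def field_simps real_sqrt_mult ennreal_mult[symmetric] split: split_indicator)
  then show ?thesis
    using assms
    by (subst nn_integral_real_affine[where c=\<sigma> and t=0])
      (simp_all add: nn_integral_cmult[symmetric] nn_integral_gaussian_tail)
qed

text \<open>The density depends on the modulus only, so the half-plane may be rotated until its
  boundary is vertical. The imaginary coordinate then integrates to 1 and a one-dimensional tail
  remains. The unit factor \<open>c\<close> allows all four directions of the decision
  boundaries.\<close>

lemma cgauss_half_plane:
  assumes v: "0 < v" and h: "h \<noteq> 0" and c: "cmod c = 1"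
  shows "(\<integral>\<^sup>+z. ennreal (cgauss_density v z) * indicator {z. t < Re (c * z / h)} z \<partial>lborel) =
    ennreal (gaussian_Q (t * cmod h / sqrt v))"
proof -
  \<comment> \<open>The unit number that is a positive multiple of \<open>c / h\<close>: dividing by
    \<open>h\<close> is a rotation by \<open>e\<close> up to \<open>c\<close>-independent scaling by
    \<open>1 / cmod h\<close>, and the scaling moves the threshold to
    \<open>t * cmod h\<close>.\<close>
  define e where "e = c * cmod h / h"
  have e: "cmod e = 1"
    using h c by (simp add: e_def norm_mult norm_divide)
  have "Re (c * z / h) = Re (e * z) / cmod h" for z
  proof -
    have "c * z / h = e * z / of_real (cmod h)"
      using h by (simp add: e_def)
    then show ?thesis by (simp only: Re_divide_of_real)
  qed
  then have half: "t < Re (c * z / h) \<longleftrightarrow> t * cmod h < Re (e * z)" for z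
    using h by (metis pos_less_divide_eq zero_less_norm_iff)
  have "(\<integral>\<^sup>+z. ennreal (cgauss_density v z) * indicator {z. t < Re (c * z / h)} z \<partial>lborel) =
      (\<integral>\<^sup>+z. ennreal (cgauss_density v (e * z)) * indicator {z. t * cmod h < Re z} (e * z) \<partial>lborel)"
    by (intro nn_integral_cong) (simp only: indicator_def mem_Collect_eq half cgauss_density_def norm_mult e mult_1)
  also have "\<dots> = (\<integral>\<^sup>+z. ennreal (cgauss_density v z) * indicator {z. t * cmod h < Re z} z \<partial>lborel)"
    by (rule nn_integral_complex_rotate[OF _ e, where F="\<lambda>z. ennreal (cgauss_density v z) * indicator {z. t * cmod h < Re z} z"])
       simp
  also have "\<dots> = (\<integral>\<^sup>+x. \<integral>\<^sup>+y. (ennreal (normal_density 0 (sqrt v) x) * indicator {t * cmod h<..} x) *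
      ennreal (normal_density 0 (sqrt v) y) \<partial>lborel \<partial>lborel)"
    using v by (subst nn_integral_complex)
      (auto intro!: nn_integral_cong simp: cgauss_density_Complex ennreal_mult normal_density_nonneg split: split_indicator)
  also have "\<dots> = ennreal (gaussian_Q (t * cmod h / sqrt v))"
    using v by (simp add: nn_integral_cmult nn_integral_normal_density nn_integral_normal_tail)
  finally show ?thesis .
qed

lemma nn_integral_cgauss_density:
  assumes "0 < v"
  shows "(\<integral>\<^sup>+z. ennreal (cgauss_density v z) \<partial>lborel) = 1"
  using assms by (subst nn_integral_complex)
    (auto simp: cgauss_density_Complex ennreal_mult normal_density_nonneg nn_integral_cmult nn_integral_normal_density)

text \<open>The density factors over the two coordinates, so the plane convolution is a product of
  two convolutions of real normal densities.\<close>

lemma cgauss_convolution: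
  assumes "0 < v" "0 < u"
  shows "(\<integral>\<^sup>+w. ennreal (cgauss_density v (z - w)) * ennreal (cgauss_density u w) \<partial>lborel) =
    ennreal (cgauss_density (v + u) z)"
proof -
  let ?c = "\<lambda>x r. ennreal (normal_density 0 (sqrt v) (x - r)) * ennreal (normal_density 0 (sqrt u) r)"
  have conv: "(\<integral>\<^sup>+r. ?c x r \<partial>lborel) = ennreal (normal_density 0 (sqrt (v + u)) x)" for x
    using conv_normal_density_zero_mean[of "sqrt v" "sqrt u"] assms
    by (simp add: fun_eq_iff ennreal_mult normal_density_nonneg)
  have "(\<integral>\<^sup>+w. ennreal (cgauss_density v (z - w)) * ennreal (cgauss_density u w) \<partial>lborel) =
      (\<integral>\<^sup>+r. \<integral>\<^sup>+s. ?c (Re z) r * ?c (Im z) s \<partial>lborel \<partial>lborel)"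
  proof (subst nn_integral_complex, simp, intro nn_integral_cong)
    fix r s
    have "z - Complex r s = Complex (Re z - r) (Im z - s)"
      by (simp add: complex_eq_iff)
    then show "ennreal (cgauss_density v (z - Complex r s)) * ennreal (cgauss_density u (Complex r s)) =
      ?c (Re z) r * ?c (Im z) s"
      using assms by (simp add: cgauss_density_Complex ennreal_mult[symmetric] normal_density_nonneg ac_simps)
  qed
  also have "\<dots> = ennreal (cgauss_density (v + u) (Complex (Re z) (Im z)))"
    using assms by (subst cgauss_density_Complex)
      (simp_all add: nn_integral_cmult nn_integral_multc conv ennreal_mult normal_density_nonneg)
  finally show ?thesis by simp
qed

subsection \<open>The Gaussian tail function\<close>

lemma nn_integral_gaussian_tail_closed:
  "(\<integral>\<^sup>+t. ennreal (std_normal_density t) * indicator {x..} t \<partial>lborel) = ennreal (gaussian_Q x)"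
  unfolding nn_integral_gaussian_tail[symmetric]
  using AE_lborel_singleton[of x] by (intro nn_integral_cong_AE) (auto split: split_indicator)

text \<open>The reflection \<open>t\<close> to \<open>-t\<close> shows that both half-lines carry
  the same share of the total mass 1.\<close>

lemma gaussian_Q_0: "gaussian_Q 0 = 1 / 2"
proof -
  have nn: "0 \<le> gaussian_Q 0"
    unfolding gaussian_Q_eq_normal by (simp add: set_lebesgue_integral_def)
  have "1 = (\<integral>\<^sup>+t. ennreal (std_normal_density t) \<partial>lborel)"
    by (simp add: nn_integral_normal_density)
  also have "\<dots> = (\<integral>\<^sup>+t. ennreal (std_normal_density t) * indicator {0..} t +
      ennreal (std_normal_density t) * indicator {..<0} t \<partial>lborel)"
    by (intro nn_integral_cong) (auto split: split_indicator)
  also have "\<dots> = ennreal (gaussian_Q 0) + (\<integral>\<^sup>+t. ennreal (std_normal_density t) * indicator {..<0} t \<partial>lborel)"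
    by (subst nn_integral_add) (simp_all add: nn_integral_gaussian_tail_closed)
  also have "(\<integral>\<^sup>+t. ennreal (std_normal_density t) * indicator {..<0} t \<partial>lborel) =
      (\<integral>\<^sup>+t. ennreal (std_normal_density t) * indicator {0<..} t \<partial>lborel)"
    by (subst nn_integral_real_affine[where c="-1" and t=0])
      (auto intro!: nn_integral_cong simp: normal_density_def split: split_indicator)
  finally have "ennreal 1 = ennreal (gaussian_Q 0) + ennreal (gaussian_Q 0)"
    by (simp add: nn_integral_gaussian_tail)
  also have "\<dots> = ennreal (gaussian_Q 0 + gaussian_Q 0)"
    using nn nn by (rule ennreal_plus[symmetric])
  finally have "ennreal 1 = ennreal (gaussian_Q 0 + gaussian_Q 0)" .
  then have "1 = gaussian_Q 0 + gaussian_Q 0"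
    using nn by (metis ennreal_inj add_nonneg_nonneg zero_le_one)
  then show ?thesis by simp
qed

lemma nn_integral_normal_half:
  assumes "0 < \<sigma>"
  shows "(\<integral>\<^sup>+t. ennreal (normal_density 0 \<sigma> t) * indicator {0<..} t \<partial>lborel) = ennreal (1 / 2)"
  using nn_integral_normal_tail[OF assms, of 0] by (simp add: gaussian_Q_0)

lemma nn_integral_exponential_Icc:
  assumes "0 \<le> a"
  shows "(\<integral>\<^sup>+x. ennreal (exponential_density 1 x) * indicator {..a} x \<partial>lborel) = ennreal (1 - exp (- a))"
proof -
  have "(\<integral>\<^sup>+x. ennreal (exponential_density 1 x) * indicator {..a} x \<partial>lborel) =
      (\<integral>\<^sup>+x. ennreal (exp (- x)) * indicator {0..a} x \<partial>lborel)"
    by (intro nn_integral_cong) (auto simp: exponential_density_def split: split_indicator)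
  also have "\<dots> = ennreal (- exp (- a) - - exp (- 0))"
    using assms by (intro nn_integral_FTC_Icc) (auto intro!: derivative_eq_intros)
  finally show ?thesis by simp
qed

section \<open>Rayleigh average of the Gaussian tail\<close>

lemma ennreal_eq_diffI:
  assumes "x + ennreal b = ennreal a" "0 \<le> b"
  shows "x = ennreal (a - b)"
proof -
  have "x = x + ennreal b - ennreal b"
    by (simp add: ennreal_add_diff_cancel_right)
  then show ?thesis
    using assms by (simp add: ennreal_minus)
qed

text \<open>Writing the tail as an integral over \<open>t\<close> and integrating over
  \<open>x\<close> first leaves the exponential distribution function at \<open>t^2 / k^2\<close>.
  Its complement \<open>exp (- t^2 / k^2)\<close> merges with the normal density into another
  centred Gaussian, so only half-line masses remain.\<close>

lemma exponential_average_gaussian_Q: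
  assumes k: "0 < k"
  shows "(\<integral>\<^sup>+x. ennreal (exponential_density 1 x) * ennreal (gaussian_Q (k * sqrt x)) \<partial>lborel) =
    ennreal ((1 - k / sqrt (k\<^sup>2 + 2)) / 2)" (is "?I = _")
proof -
  \<comment> \<open>The standard deviation of the merged Gaussian:
    \<open>1 / s^2 = 1 + 2 / k^2\<close>. The change of normalisation contributes the factor
    \<open>s\<close>.\<close>
  define s where "s = k / sqrt (k\<^sup>2 + 2)"
  have k2: "0 < k\<^sup>2 + 2" by (simp add: add_nonneg_pos)
  have s: "0 < s" using k k2 by (simp add: s_def)
  let ?\<phi> = "std_normal_density" and ?E = "exponential_density 1 :: real \<Rightarrow> real"
  let ?g = "\<lambda>t. ennreal (?\<phi> t * exp (- t\<^sup>2 / k\<^sup>2)) * indicator {0<..} t"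
  have "?I = (\<integral>\<^sup>+x. \<integral>\<^sup>+t. ennreal (?E x) * (ennreal (?\<phi> t) * indicator {k * sqrt x..} t) \<partial>lborel \<partial>lborel)"
    by (simp add: nn_integral_cmult nn_integral_gaussian_tail_closed)
  also have "\<dots> = (\<integral>\<^sup>+x. \<integral>\<^sup>+t. ennreal (?E x) * (ennreal (?\<phi> t) * indicator {x. k * sqrt (fst x) \<le> snd x} (x, t)) \<partial>lborel \<partial>lborel)"
    by (intro nn_integral_cong) (auto split: split_indicator)
  also have "\<dots> = (\<integral>\<^sup>+t. \<integral>\<^sup>+x. ennreal (?E x) * (ennreal (?\<phi> t) * indicator {x. k * sqrt (fst x) \<le> snd x} (x, t)) \<partial>lborel \<partial>lborel)"
    by (rule lborel_pair.Fubini'[symmetric]) measurable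
  also have "\<dots> = (\<integral>\<^sup>+t. ennreal (?\<phi> t * (1 - exp (- t\<^sup>2 / k\<^sup>2))) * indicator {0<..} t \<partial>lborel)"
  proof (rule nn_integral_cong)
    fix t :: real
    show "(\<integral>\<^sup>+x. ennreal (?E x) * (ennreal (?\<phi> t) * indicator {x. k * sqrt (fst x) \<le> snd x} (x, t)) \<partial>lborel) =
      ennreal (?\<phi> t * (1 - exp (- t\<^sup>2 / k\<^sup>2))) * indicator {0<..} t"
    proof (cases "0 < t")
      case True
      have iff: "k * sqrt x \<le> t \<longleftrightarrow> x \<le> t\<^sup>2 / k\<^sup>2" if "0 \<le> x" for x
      proof -
        have "k * sqrt x \<le> t \<longleftrightarrow> sqrt x \<le> t / k"
          using k by (simp add: field_simps)
        also have "\<dots> \<longleftrightarrow> x \<le> (t / k)\<^sup>2"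
          using that k True by (metis abs_of_pos divide_pos_pos real_sqrt_abs real_sqrt_le_iff)
        finally show ?thesis by (simp add: power_divide)
      qed
      have "(\<integral>\<^sup>+x. ennreal (?E x) * (ennreal (?\<phi> t) * indicator {x. k * sqrt (fst x) \<le> snd x} (x, t)) \<partial>lborel) =
          (\<integral>\<^sup>+x. ennreal (?\<phi> t) * (ennreal (?E x) * indicator {..t\<^sup>2 / k\<^sup>2} x) \<partial>lborel)"
        by (intro nn_integral_cong) (auto simp: iff exponential_density_def mult.commute split: split_indicator)
      also have "\<dots> = ennreal (?\<phi> t) * ennreal (1 - exp (- (t\<^sup>2 / k\<^sup>2)))"
        by (simp add: nn_integral_cmult nn_integral_exponential_Icc)
      finally show ?thesis
        using True by (simp add: ennreal_mult)
    next
      case False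
      \<comment> \<open>For \<open>t\<close> at most 0 the indicator together with the exponential
        density leaves at most the point \<open>x = 0\<close>.\<close>
      have "AE x in lborel. x \<noteq> (0::real)"
        by (rule AE_lborel_singleton)
      then have "AE x in lborel. ennreal (?E x) * (ennreal (?\<phi> t) * indicator {x. k * sqrt (fst x) \<le> snd x} (x, t)) = 0"
      proof (rule AE_mp, intro AE_I2 impI)
        fix x :: real assume "x \<noteq> 0"
        moreover have "\<not> k * sqrt x \<le> t" if "0 < x"
          using mult_pos_pos[OF k, of "sqrt x"] that False by simp
        ultimately show "ennreal (?E x) * (ennreal (?\<phi> t) * indicator {x. k * sqrt (fst x) \<le> snd x} (x, t)) = 0"
          by (cases "x < 0") (auto simp: exponential_density_def split: split_indicator)
      qed
      then show ?thesis
        using False by (subst nn_integral_cong_AE[where v="\<lambda>_. 0"]) auto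
    qed
  qed
  finally have I: "?I = \<dots>" .
  \<comment> \<open>The complementary term is added rather than subtracted, so that no difference of
    \<open>ennreal\<close> integrals arises; it is removed at the end, where its value
    \<open>s / 2\<close> is known to be finite.\<close>
  have "?I + (\<integral>\<^sup>+t. ?g t \<partial>lborel) = (\<integral>\<^sup>+t. ennreal (?\<phi> t) * indicator {0<..} t \<partial>lborel)"
    unfolding I
  proof (subst nn_integral_add[symmetric], simp, simp, rule nn_integral_cong)
    fix t
    have "0 \<le> ?\<phi> t * (1 - exp (- t\<^sup>2 / k\<^sup>2))"
      by (intro mult_nonneg_nonneg) auto
    then have "ennreal (?\<phi> t * (1 - exp (- t\<^sup>2 / k\<^sup>2))) + ennreal (?\<phi> t * exp (- t\<^sup>2 / k\<^sup>2)) =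
        ennreal (?\<phi> t * (1 - exp (- t\<^sup>2 / k\<^sup>2)) + ?\<phi> t * exp (- t\<^sup>2 / k\<^sup>2))"
      by (intro ennreal_plus[symmetric]) auto
    then show "ennreal (?\<phi> t * (1 - exp (- t\<^sup>2 / k\<^sup>2))) * indicator {0<..} t + ?g t = ennreal (?\<phi> t) * indicator {0<..} t"
      by (simp add: right_diff_distrib split: split_indicator)
  qed
  also have "\<dots> = ennreal (1 / 2)"
    by (rule nn_integral_normal_half) simp
  also have "(\<integral>\<^sup>+t. ?g t \<partial>lborel) = (\<integral>\<^sup>+t. ennreal s * (ennreal (normal_density 0 s t) * indicator {0<..} t) \<partial>lborel)"
  proof (rule nn_integral_cong)
    fix t
    have s2: "s\<^sup>2 = k\<^sup>2 / (k\<^sup>2 + 2)"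
      using k2 by (simp add: s_def power_divide)
    have "- t\<^sup>2 / 2 + - t\<^sup>2 / k\<^sup>2 = - t\<^sup>2 / (2 * s\<^sup>2)"
      unfolding s2 using k k2 by (simp add: field_simps)
    then have "?\<phi> t * exp (- t\<^sup>2 / k\<^sup>2) = s * normal_density 0 s t"
      using s by (simp add: normal_density_def real_sqrt_mult flip: exp_add)
    then show "?g t = ennreal s * (ennreal (normal_density 0 s t) * indicator {0<..} t)"
      using s by (simp add: ennreal_mult normal_density_nonneg ac_simps)
  qed
  also have "\<dots> = ennreal s * ennreal (1 / 2)"
    by (subst nn_integral_cmult) (simp_all only: nn_integral_normal_half[OF s], simp)
  also have "\<dots> = ennreal (s / 2)"
    using s by (subst ennreal_mult[symmetric]) auto
  finally have "?I + ennreal (s / 2) = ennreal (1 / 2)" .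
  then have "?I = ennreal (1 / 2 - s / 2)"
    using s by (intro ennreal_eq_diffI) auto
  then show ?thesis
    by (simp add: s_def diff_divide_distrib)
qed

text \<open>A fixed base point \<open>a\<close> turns the tail into an integral with variable upper
  limit, to which the fundamental theorem applies.\<close>

lemma gaussian_Q_add_integral:
  assumes "a \<le> x"
  shows "gaussian_Q x = gaussian_Q a - integral {a..x} std_normal_density"
proof -
  have int: "set_integrable lborel A std_normal_density" if "A \<in> sets borel" for A
    using that unfolding set_integrable_def by (intro integrable_mult_indicator) auto
  have "{a..} = {a..<x} \<union> {x..}"
    using assms by auto
  then have "gaussian_Q a = (LINT t:{a..<x}|lborel. std_normal_density t) + gaussian_Q x"
    unfolding gaussian_Q_eq_normal by (simp only:, intro set_integral_Un) (auto intro!: int)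
  also have "(LINT t:{a..<x}|lborel. std_normal_density t) = (LINT t:{a..x}|lborel. std_normal_density t)"
    using AE_lborel_singleton[of x] unfolding set_lebesgue_integral_def
    by (intro integral_cong_AE) (auto split: split_indicator)
  also have "\<dots> = integral {a..x} std_normal_density"
    by (intro set_borel_integral_eq_integral int) auto
  finally show ?thesis by simp
qed

lemma DERIV_gaussian_Q [THEN DERIV_chain2, derivative_intros]:
  "(gaussian_Q has_real_derivative - std_normal_density x) (at x)"
proof -
  have "((\<lambda>y. integral {x - 1..y} std_normal_density) has_real_derivative std_normal_density x) (at x within {x - 1..x + 1})"
    by (intro integral_has_real_derivative) (auto simp: normal_density_def intro!: continuous_intros)
  then have "((\<lambda>y. integral {x - 1..y} std_normal_density) has_real_derivative std_normal_density x) (at x)"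
    by (subst (asm) at_within_Icc_at) auto
  then have "((\<lambda>y. gaussian_Q (x - 1) - integral {x - 1..y} std_normal_density) has_real_derivative - std_normal_density x) (at x)"
    by (auto intro!: derivative_eq_intros)
  then show ?thesis
    by (rule has_field_derivative_transform_within[where d=1])
      (auto simp: dist_real_def gaussian_Q_add_integral[symmetric])
qed

lemma gaussian_Q_nonneg: "0 \<le> gaussian_Q x"
  unfolding gaussian_Q_eq_normal set_lebesgue_integral_def by simp

lemma gaussian_Q_at_top: "(gaussian_Q \<longlongrightarrow> 0) at_top"
proof -
  have "((\<lambda>y. \<integral>x. indicator {..y} x *\<^sub>R std_normal_density x \<partial>lborel) \<longlongrightarrow> (\<integral>x. std_normal_density x \<partial>lborel)) at_top"
    by (intro tendsto_integral_at_top) auto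
  then have lim: "((\<lambda>y. 1 - (\<integral>x. indicator {..y} x *\<^sub>R std_normal_density x \<partial>lborel)) \<longlongrightarrow> 1 - 1) at_top"
    by (intro tendsto_diff) auto
  have int: "set_integrable lborel A std_normal_density" if "A \<in> sets borel" for A
    using that unfolding set_integrable_def by (intro integrable_mult_indicator) auto
  have "gaussian_Q y = 1 - (\<integral>x. indicator {..y} x *\<^sub>R std_normal_density x \<partial>lborel)" for y
  proof -
    have "{..<y} \<union> {y..} = UNIV"
      by auto
    then have "1 = (LINT t:({..<y} \<union> {y..})|lborel. std_normal_density t)"
      by (simp add: set_lebesgue_integral_def)
    also have "\<dots> = (LINT t:{..<y}|lborel. std_normal_density t) + gaussian_Q y"
      unfolding gaussian_Q_eq_normal by (intro set_integral_Un) (auto intro!: int)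
    also have "(LINT t:{..<y}|lborel. std_normal_density t) = (\<integral>x. indicator {..y} x *\<^sub>R std_normal_density x \<partial>lborel)"
      using AE_lborel_singleton[of y] unfolding set_lebesgue_integral_def
      by (intro integral_cong_AE) (auto split: split_indicator)
    finally show ?thesis by simp
  qed
  then have "gaussian_Q = (\<lambda>y. 1 - (\<integral>x. indicator {..y} x *\<^sub>R std_normal_density x \<partial>lborel))"
    by (rule ext)
  then show ?thesis
    using lim by simp
qed

text \<open>The antiderivative \<open>?F\<close> comes from
  \<open>u = sqrt (2 * (x + \<psi>))\<close>: then
  \<open>exp (- x) = exp \<psi> * exp (- u^2 / 2)\<close>, and
  \<open>sqrt (\<psi> / (x + \<psi>)) dx\<close> becomes \<open>sqrt (2 * \<psi>) du\<close>. What
  remains is a Gaussian tail times \<open>sqrt (2 * pi)\<close>, whence the constant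
  \<open>2 * sqrt (\<psi> * pi)\<close>.\<close>

lemma exponential_tail_integral:
  assumes \<psi>: "0 < \<psi>" and \<theta>: "0 \<le> \<theta>"
  shows "(\<integral>\<^sup>+x. ennreal (exponential_density 1 x) * (indicator {\<theta><..} x * ennreal (1 - sqrt (\<psi> / (x + \<psi>)))) \<partial>lborel) =
    ennreal (exp (- \<theta>) - 2 * sqrt (\<psi> * pi) * exp \<psi> * gaussian_Q (sqrt (2 * (\<theta> + \<psi>))))"
    and "0 \<le> exp (- \<theta>) - 2 * sqrt (\<psi> * pi) * exp \<psi> * gaussian_Q (sqrt (2 * (\<theta> + \<psi>)))"
proof -
  let ?f = "\<lambda>x. exp (- x) * (1 - sqrt (\<psi> / (x + \<psi>)))"
  let ?F = "\<lambda>x. - exp (- x) + 2 * sqrt (\<psi> * pi) * exp \<psi> * gaussian_Q (sqrt (2 * (x + \<psi>)))"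
  have deriv: "(?F has_real_derivative ?f x) (at x)" and nonneg: "0 \<le> ?f x" if "\<theta> \<le> x" for x
  proof -
    from that have x: "0 < x + \<psi>" "0 \<le> x" using \<psi> \<theta> by auto
    define r where "r = sqrt (x + \<psi>)"
    have r: "0 < r" "r\<^sup>2 = x + \<psi>" using x by (simp_all add: r_def)
    have e: "exp (- (2 * (x + \<psi>)) / 2) = exp (- x) * exp (- \<psi>)"
      by (simp flip: exp_add)
    have "(?F has_real_derivative exp (- x) + 2 * sqrt (\<psi> * pi) * exp \<psi> *
        (- std_normal_density (sqrt (2 * (x + \<psi>))) * (2 * (inverse (sqrt (2 * (x + \<psi>))) / 2)))) (at x)"
      using x by (auto intro!: derivative_eq_intros)
    moreover have "exp (- x) + 2 * sqrt (\<psi> * pi) * exp \<psi> *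
        (- std_normal_density (sqrt (2 * (x + \<psi>))) * (2 * (inverse (sqrt (2 * (x + \<psi>))) / 2))) = ?f x"
    proof -
      have "std_normal_density (sqrt (2 * (x + \<psi>))) = exp (- x) * exp (- \<psi>) / (sqrt 2 * sqrt pi)"
        using x e by (simp add: normal_density_def real_sqrt_mult)
      then have "exp \<psi> * std_normal_density (sqrt (2 * (x + \<psi>))) = exp (- x) / (sqrt 2 * sqrt pi)"
        by (simp add: exp_minus)
      then have "2 * sqrt (\<psi> * pi) * (exp \<psi> * std_normal_density (sqrt (2 * (x + \<psi>)))) *
          inverse (sqrt 2 * r) = exp (- x) * (sqrt \<psi> / r)"
        using r(1) by (simp only: real_sqrt_mult) (simp add: field_simps)
      then have "2 * sqrt (\<psi> * pi) * (exp \<psi> * std_normal_density (sqrt (2 * (x + \<psi>)))) *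
          inverse (sqrt (2 * (x + \<psi>))) = exp (- x) * (sqrt \<psi> / r)"
        by (simp only: r_def real_sqrt_mult[of 2 "x + \<psi>"])
      moreover have "exp (- x) + 2 * sqrt (\<psi> * pi) * exp \<psi> *
          (- std_normal_density (sqrt (2 * (x + \<psi>))) * (2 * (inverse (sqrt (2 * (x + \<psi>))) / 2))) =
          exp (- x) - 2 * sqrt (\<psi> * pi) * (exp \<psi> * std_normal_density (sqrt (2 * (x + \<psi>)))) *
          inverse (sqrt (2 * (x + \<psi>)))"
        by simp
      ultimately show ?thesis
        by (simp only: r_def right_diff_distrib mult_1_right real_sqrt_divide)
    qed
    ultimately show "(?F has_real_derivative ?f x) (at x)" by simp
    show "0 \<le> ?f x"
      using x \<psi> by (auto simp: field_simps)
  qed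
  have lim: "(?F \<longlongrightarrow> 0) at_top"
  proof -
    have 1: "((\<lambda>x::real. exp (- x)) \<longlongrightarrow> 0) at_top"
      by (rule filterlim_compose[OF exp_at_bot filterlim_uminus_at_bot_at_top])
    have "filterlim (\<lambda>x. sqrt (2 * (x + \<psi>))) at_top at_top"
      by real_asymp
    then have "((\<lambda>x. gaussian_Q (sqrt (2 * (x + \<psi>)))) \<longlongrightarrow> 0) at_top"
      by (rule filterlim_compose[OF gaussian_Q_at_top])
    from tendsto_add[OF tendsto_minus[OF 1] tendsto_mult_left[OF this, of "2 * sqrt (\<psi> * pi) * exp \<psi>"]]
    show ?thesis by simp
  qed
  \<comment> \<open>Nonnegativity of the closed form is needed separately, because
    \<open>ennreal\<close> would hide a negative value: \<open>?F\<close> increases to its limit 0,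
    so it is at most 0 at \<theta>.\<close>
  have "?F \<theta> \<le> ?F y" if "\<theta> \<le> y" for y
    using that deriv nonneg by (intro DERIV_nonneg_imp_nondecreasing[of \<theta> y ?F]) fastforce+
  then have "?F \<theta> \<le> 0"
    by (intro tendsto_lowerbound[OF lim]) (auto simp: eventually_at_top_linorder)
  then show "0 \<le> exp (- \<theta>) - 2 * sqrt (\<psi> * pi) * exp \<psi> * gaussian_Q (sqrt (2 * (\<theta> + \<psi>)))"
    by simp
  have "(\<integral>\<^sup>+x. ennreal (exponential_density 1 x) * (indicator {\<theta><..} x * ennreal (1 - sqrt (\<psi> / (x + \<psi>)))) \<partial>lborel) =
      (\<integral>\<^sup>+x. ennreal (?f x) * indicator {\<theta>..} x \<partial>lborel)"
    using AE_lborel_singleton[of \<theta>] \<theta>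
    by (intro nn_integral_cong_AE) (auto simp: exponential_density_def ennreal_mult' split: split_indicator)
  also have "\<dots> = ennreal (0 - ?F \<theta>)"
    by (rule nn_integral_FTC_atLeast[OF _ deriv nonneg lim]) measurable
  finally show "(\<integral>\<^sup>+x. ennreal (exponential_density 1 x) * (indicator {\<theta><..} x * ennreal (1 - sqrt (\<psi> / (x + \<psi>)))) \<partial>lborel) =
      ennreal (exp (- \<theta>) - 2 * sqrt (\<psi> * pi) * exp \<psi> * gaussian_Q (sqrt (2 * (\<theta> + \<psi>))))"
    by simp
qed

subsection \<open>The law of fading, symbol and noise\<close>

lemma pair_measure_triple_eqI:
  assumes prob: "prob_space D1" "prob_space D2" "prob_space D3"
    and sets: "sets D = sets (D1 \<Otimes>\<^sub>M (D2 \<Otimes>\<^sub>M D3))"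
    and rect: "\<And>A B C. A \<in> sets D1 \<Longrightarrow> B \<in> sets D2 \<Longrightarrow> C \<in> sets D3 \<Longrightarrow>
      emeasure D1 A * (emeasure D2 B * emeasure D3 C) = emeasure D (A \<times> B \<times> C)"
  shows "D1 \<Otimes>\<^sub>M (D2 \<Otimes>\<^sub>M D3) = D"
proof -
  interpret D1: prob_space D1 by fact
  interpret D2: prob_space D2 by fact
  interpret D3: prob_space D3 by fact
  interpret D23: pair_prob_space D2 D3 ..
  note [measurable_cong] = sets
  show ?thesis
  proof (rule pair_measure_eqI)
    fix A W assume A[measurable]: "A \<in> sets D1" and W[measurable]: "W \<in> sets (D2 \<Otimes>\<^sub>M D3)"
    let ?a = "emeasure D1 A"
    \<comment> \<open>For fixed \<open>A\<close> both sides are product measures in \<open>W\<close>, so rectangles \<open>W\<close> suffice.\<close>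
    define R where "R = distr (density D (indicator (A \<times> space (D2 \<Otimes>\<^sub>M D3)))) (D2 \<Otimes>\<^sub>M D3) snd"
    have snd[measurable]: "snd \<in> measurable D (D2 \<Otimes>\<^sub>M D3)"
      by (simp add: measurable_cong_sets[OF sets refl])
    have R: "emeasure R V = emeasure D (A \<times> V)" if [measurable]: "V \<in> sets (D2 \<Otimes>\<^sub>M D3)" for V
    proof -
      have AV: "A \<times> V \<in> sets D"
        by (simp add: sets)
      have "emeasure R V = emeasure (density D (indicator (A \<times> space (D2 \<Otimes>\<^sub>M D3)))) (snd -` V \<inter> space D)"
        unfolding R_def by (subst emeasure_distr) simp_all
      also have "\<dots> = (\<integral>\<^sup>+x. indicator (A \<times> space (D2 \<Otimes>\<^sub>M D3)) x * indicator (snd -` V \<inter> space D) x \<partial>D)"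
      proof (rule emeasure_density)
        have "A \<times> space (D2 \<Otimes>\<^sub>M D3) \<in> sets D"
          using A by (auto simp: sets)
        then show "(indicator (A \<times> space (D2 \<Otimes>\<^sub>M D3)) :: _ \<Rightarrow> ennreal) \<in> borel_measurable D" by simp
      qed measurable
      also have "\<dots> = (\<integral>\<^sup>+x. indicator (A \<times> V) x \<partial>D)"
        using sets.sets_into_space[OF that] by (intro nn_integral_cong) (auto split: split_indicator)
      finally show ?thesis using AV by simp
    qed
    \<comment> \<open>The mass of \<open>A\<close> is absorbed into the factor \<open>D2\<close>, so
      that the product rule for two measures applies again; the scaled measure is finite but in
      general no longer a probability.\<close>
    have "scale_measure ?a D2 \<Otimes>\<^sub>M D3 = R"
    proof (rule pair_measure_eqI)
      have "finite_measure (scale_measure ?a D2)"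
        by (rule finite_measureI) (simp add: space_scale_measure D1.emeasure_eq_measure D2.emeasure_space_1)
      then show "sigma_finite_measure (scale_measure ?a D2)"
        by (simp add: finite_measure.sigma_finite_measure)
      show "sets (scale_measure ?a D2 \<Otimes>\<^sub>M D3) = sets R"
        by (simp add: R_def cong: sets_pair_measure_cong)
      fix B C assume "B \<in> sets (scale_measure ?a D2)" "C \<in> sets D3"
      then show "emeasure (scale_measure ?a D2) B * emeasure D3 C = emeasure R (B \<times> C)"
        by (simp add: R rect[OF A, symmetric] mult.assoc)
    qed unfold_locales
    then have "emeasure D (A \<times> W) = emeasure (scale_measure ?a D2 \<Otimes>\<^sub>M D3) W"
      by (simp add: R)
    also have "\<dots> = (\<integral>\<^sup>+x. emeasure D3 (Pair x -` W) \<partial>scale_measure ?a D2)"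
      by (rule D3.emeasure_pair_measure_alt) (simp cong: sets_pair_measure_cong)
    also have "\<dots> = ?a * (\<integral>\<^sup>+x. emeasure D3 (Pair x -` W) \<partial>D2)"
      by (rule nn_integral_scale_measure) (rule D3.measurable_emeasure_Pair[OF W])
    also have "\<dots> = ?a * emeasure (D2 \<Otimes>\<^sub>M D3) W"
      by (simp add: D3.emeasure_pair_measure_alt)
    finally show "?a * emeasure (D2 \<Otimes>\<^sub>M D3) W = emeasure D (A \<times> W)" ..
  qed (simp_all add: sets, unfold_locales)
qed

lemma indep_triple_emeasure:
  assumes "prob_space M" and ind: "indep_triple M N1 X1 N2 X2 N3 X3"
    and "A \<in> sets N1" "B \<in> sets N2" "C \<in> sets N3"
  shows "emeasure M {\<omega> \<in> space M. X1 \<omega> \<in> A \<and> X2 \<omega> \<in> B \<and> X3 \<omega> \<in> C} =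
    emeasure (distr M N1 X1) A * (emeasure (distr M N2 X2) B * emeasure (distr M N3 X3) C)"
proof -
  interpret prob_space M by fact
  let ?E = "nth [X1 -` A \<inter> space M, X2 -` B \<inter> space M, X3 -` C \<inter> space M]"
  have three: "{..<3} = {0, 1, 2 :: nat}" by auto
  have "prob (\<Inter>j\<in>{..<3}. ?E j) = (\<Prod>j\<in>{..<3}. prob (?E j))"
    using assms by (intro indep_setsD[where F="nth [preimage_events M N1 X1, preimage_events M N2 X2, preimage_events M N3 X3]"
          and I="{..<3}"]) (auto simp: indep_triple_def three preimage_events_def)
  moreover have "(\<Inter>j\<in>{..<3}. ?E j) = {\<omega> \<in> space M. X1 \<omega> \<in> A \<and> X2 \<omega> \<in> B \<and> X3 \<omega> \<in> C}"
    by (auto simp: three)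
  ultimately have "prob {\<omega> \<in> space M. X1 \<omega> \<in> A \<and> X2 \<omega> \<in> B \<and> X3 \<omega> \<in> C} =
      prob (X1 -` A \<inter> space M) * (prob (X2 -` B \<inter> space M) * prob (X3 -` C \<inter> space M))"
    by (simp add: three)
  then show ?thesis
    using assms by (simp add: indep_triple_def emeasure_distr emeasure_eq_measure ennreal_mult)
qed

lemma indep_triple_distr:
  assumes M: "prob_space M" and ind: "indep_triple M N1 X1 N2 X2 N3 X3"
  shows "distr M N1 X1 \<Otimes>\<^sub>M (distr M N2 X2 \<Otimes>\<^sub>M distr M N3 X3) =
    distr M (N1 \<Otimes>\<^sub>M (N2 \<Otimes>\<^sub>M N3)) (\<lambda>\<omega>. (X1 \<omega>, X2 \<omega>, X3 \<omega>))"
proof (rule pair_measure_triple_eqI)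
  have [measurable]: "X1 \<in> measurable M N1" "X2 \<in> measurable M N2" "X3 \<in> measurable M N3"
    using ind by (simp_all add: indep_triple_def)
  interpret prob_space M by fact
  show "prob_space (distr M N1 X1)" "prob_space (distr M N2 X2)" "prob_space (distr M N3 X3)"
    by (simp_all add: prob_space_distr)
  show "sets (distr M (N1 \<Otimes>\<^sub>M (N2 \<Otimes>\<^sub>M N3)) (\<lambda>\<omega>. (X1 \<omega>, X2 \<omega>, X3 \<omega>))) =
      sets (distr M N1 X1 \<Otimes>\<^sub>M (distr M N2 X2 \<Otimes>\<^sub>M distr M N3 X3))"
    by (simp cong: sets_pair_measure_cong)
  fix A B C assume "A \<in> sets (distr M N1 X1)" "B \<in> sets (distr M N2 X2)" "C \<in> sets (distr M N3 X3)"
  then have [measurable]: "A \<in> sets N1" "B \<in> sets N2" "C \<in> sets N3" by simp_all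
  have "emeasure (distr M (N1 \<Otimes>\<^sub>M (N2 \<Otimes>\<^sub>M N3)) (\<lambda>\<omega>. (X1 \<omega>, X2 \<omega>, X3 \<omega>))) (A \<times> B \<times> C) =
      emeasure M {\<omega> \<in> space M. X1 \<omega> \<in> A \<and> X2 \<omega> \<in> B \<and> X3 \<omega> \<in> C}"
    by (subst emeasure_distr) (auto intro!: arg_cong[where f="emeasure M"])
  then show "emeasure (distr M N1 X1) A * (emeasure (distr M N2 X2) B * emeasure (distr M N3 X3) C) =
      emeasure (distr M (N1 \<Otimes>\<^sub>M (N2 \<Otimes>\<^sub>M N3)) (\<lambda>\<omega>. (X1 \<omega>, X2 \<omega>, X3 \<omega>))) (A \<times> B \<times> C)"
    using indep_triple_emeasure[OF M ind, of A B C] by simp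
qed

section \<open>The density of noise plus interference\<close>

lemma nn_integral_lborel_translate:
  fixes c :: "'a::euclidean_space"
  assumes [measurable]: "f \<in> borel_measurable borel"
  shows "(\<integral>\<^sup>+x. f (c + x) \<partial>lborel) = (\<integral>\<^sup>+x. f x \<partial>lborel)"
  using nn_integral_distr[of "(+) c" lborel borel f] by (simp add: lborel_distr_plus)

lemma distr_add_density:
  fixes f g :: "'a::euclidean_space \<Rightarrow> ennreal"
  assumes [measurable]: "f \<in> borel_measurable borel" "g \<in> borel_measurable borel"
    and "sigma_finite_measure (density lborel g)"
  shows "distr (density lborel f \<Otimes>\<^sub>M density lborel g) borel (\<lambda>(x, y). x + y) =
    density lborel (\<lambda>x. \<integral>\<^sup>+y. f (x - y) * g y \<partial>lborel)"
proof (rule measure_eqI)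
  fix A :: "'a set"
  assume "A \<in> sets (distr (density lborel f \<Otimes>\<^sub>M density lborel g) borel (\<lambda>(x, y). x + y))"
  then have [measurable]: "A \<in> sets borel" by simp
  have "emeasure (distr (density lborel f \<Otimes>\<^sub>M density lborel g) borel (\<lambda>(x, y). x + y)) A =
      (\<integral>\<^sup>+z. indicator A z \<partial>distr (density lborel f \<Otimes>\<^sub>M density lborel g) borel (\<lambda>(x, y). x + y))"
    by simp
  also have "\<dots> = (\<integral>\<^sup>+p. indicator A (fst p + snd p) \<partial>(density lborel f \<Otimes>\<^sub>M density lborel g))"
    by (subst nn_integral_distr) (simp_all add: split_beta')
  also have "\<dots> = (\<integral>\<^sup>+p. f (fst p) * g (snd p) * indicator A (fst p + snd p) \<partial>(lborel \<Otimes>\<^sub>M lborel))"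
    using assms by (subst pair_measure_density) (simp_all add: nn_integral_density split_beta' lborel.sigma_finite_measure_axioms)
  also have "\<dots> = (\<integral>\<^sup>+y. \<integral>\<^sup>+x. f x * g y * indicator A (x + y) \<partial>lborel \<partial>lborel)"
    by (subst lborel_pair.nn_integral_snd[symmetric]) (simp_all add: split_beta')
  also have "\<dots> = (\<integral>\<^sup>+y. \<integral>\<^sup>+x. f (x - y) * g y * indicator A x \<partial>lborel \<partial>lborel)"
  proof (rule nn_integral_cong)
    fix y
    show "(\<integral>\<^sup>+x. f x * g y * indicator A (x + y) \<partial>lborel) = (\<integral>\<^sup>+x. f (x - y) * g y * indicator A x \<partial>lborel)"
      using nn_integral_lborel_translate[of "\<lambda>x. f x * g y * indicator A (x + y)" "- y"] by simp
  qed
  also have "\<dots> = (\<integral>\<^sup>+x. \<integral>\<^sup>+y. f (x - y) * g y * indicator A x \<partial>lborel \<partial>lborel)"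
    by (rule lborel_pair.Fubini') simp
  also have "\<dots> = emeasure (density lborel (\<lambda>x. \<integral>\<^sup>+y. f (x - y) * g y \<partial>lborel)) A"
    by (simp add: emeasure_density nn_integral_multc)
  finally show "emeasure (distr (density lborel f \<Otimes>\<^sub>M density lborel g) borel (\<lambda>(x, y). x + y)) A =
    emeasure (density lborel (\<lambda>x. \<integral>\<^sup>+y. f (x - y) * g y \<partial>lborel)) A" .
qed simp

lemma ennreal_sum_mult:
  assumes "\<And>l. l \<in> A \<Longrightarrow> 0 \<le> c l" "\<And>l. l \<in> A \<Longrightarrow> 0 \<le> g l"
  shows "ennreal (\<Sum>l\<in>A. c l * g l) = (\<Sum>l\<in>A. ennreal (c l) * ennreal (g l))"
  using assms by (subst sum_ennreal[symmetric]) (auto simp: ennreal_mult)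

text \<open>The noise seen by the receiver in state \<open>j\<close> is a mixture of circular Gaussians; for \<open>j = False\<close>
  it has the single component \<open>l = 0\<close>.\<close>

definition noise_comps :: "'a osa_system \<Rightarrow> bool \<Rightarrow> nat set" where
  "noise_comps S j = (if j then {1..mix_number S} else {0})"

definition noise_weight :: "'a osa_system \<Rightarrow> bool \<Rightarrow> nat \<Rightarrow> real" where
  "noise_weight S j l = (if j then mix_weight S l else 1)"

definition noise_var :: "'a osa_system \<Rightarrow> bool \<Rightarrow> nat \<Rightarrow> real" where
  "noise_var S j l = (if j then (mix_sigma S l)\<^sup>2 + (sigma_noise S)\<^sup>2 else (sigma_noise S)\<^sup>2)"

text \<open>The state is a parameter here, not read off from the outcome. The function is thereby a
  fixed map of noise and interference, and it is the disturbance at the receiver only almost surely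
  under \<open>given_idle_state S j\<close>.\<close>

definition total_noise :: "'a osa_system \<Rightarrow> bool \<Rightarrow> 'a \<Rightarrow> complex" where
  "total_noise S j \<omega> = noise S \<omega> + (if j then interference S \<omega> else 0)"

definition total_noise_density :: "'a osa_system \<Rightarrow> bool \<Rightarrow> complex \<Rightarrow> real" where
  "total_noise_density S j z = (\<Sum>l\<in>noise_comps S j. noise_weight S j l * cgauss_density (noise_var S j l) z)"

lemma measurable_gauss_mixture_density [measurable]: "gauss_mixture_density p c \<sigma> \<in> borel_measurable borel"
  unfolding gauss_mixture_density_def by measurable

lemma measurable_total_noise_density [measurable]: "total_noise_density S j \<in> borel_measurable borel"
  unfolding total_noise_density_def by measurable

abbreviation idle_event :: "'a osa_system \<Rightarrow> bool \<Rightarrow> 'a set" where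
  "idle_event S j \<equiv> {\<omega> \<in> space (prob_of S). \<not> busy S \<omega> \<and> active S \<omega> = j}"

abbreviation index_law :: "'a osa_system \<Rightarrow> (nat \<times> nat) measure" where
  "index_law S \<equiv> measure_pmf (pmf_of_set ({..<size_I S} \<times> {..<size_Q S}))"

context osa_model
begin

lemma noise_var_gt_0: "l \<in> noise_comps S j \<Longrightarrow> 0 < noise_var S j l"
  using noise_var_pos mix_var_pos[of l] by (auto simp: noise_var_def noise_comps_def intro!: add_pos_pos split: if_splits)

lemma noise_weight_nonneg: "l \<in> noise_comps S j \<Longrightarrow> 0 \<le> noise_weight S j l"
  using mix_weight_nonneg by (auto simp: noise_weight_def noise_comps_def split: if_splits)

lemma noise_weight_sum: "(\<Sum>l\<in>noise_comps S j. noise_weight S j l) = 1"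
  using mix_weight_sum by (auto simp: noise_weight_def noise_comps_def)

lemma finite_noise_comps [simp]: "finite (noise_comps S j)"
  by (simp add: noise_comps_def)

text \<open>Single weights may vanish. This component makes the mixture density strictly positive
  and strictly decreasing in the modulus.\<close>

lemma noise_weight_pos: "\<exists>l\<in>noise_comps S j. 0 < noise_weight S j l"
proof (rule ccontr)
  assume "\<not> ?thesis"
  then have "(\<Sum>l\<in>noise_comps S j. noise_weight S j l) \<le> 0"
    by (intro sum_nonpos) auto
  then show False using noise_weight_sum[of j] by simp
qed

lemma measurable_model [measurable]:
  "Measurable.pred (prob_of S) (active S)" "Measurable.pred (prob_of S) (busy S)"
  "symbol_index S \<in> measurable (prob_of S) (count_space UNIV)"
  "noise S \<in> borel_measurable (prob_of S)" "interference S \<in> borel_measurable (prob_of S)"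
  "fading_h S \<in> borel_measurable (prob_of S)" "fading_g S \<in> borel_measurable (prob_of S)"
proof -
  have X: "(\<lambda>\<omega>. (active S \<omega>, busy S \<omega>, symbol_index S \<omega>, noise S \<omega>, interference S \<omega>)) \<in>
      measurable (prob_of S) (count_space UNIV \<Otimes>\<^sub>M count_space UNIV \<Otimes>\<^sub>M count_space UNIV \<Otimes>\<^sub>M borel \<Otimes>\<^sub>M borel)"
    using fading_indep by (simp add: indep_triple_def)
  note snd1 = measurable_compose[OF X measurable_snd]
  note snd2 = measurable_compose[OF snd1 measurable_snd]
  note snd3 = measurable_compose[OF snd2 measurable_snd]
  show "Measurable.pred (prob_of S) (active S)"
    using measurable_compose[OF X measurable_fst] by simp
  show "Measurable.pred (prob_of S) (busy S)"
    using measurable_compose[OF snd1 measurable_fst] by simp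
  show "symbol_index S \<in> measurable (prob_of S) (count_space UNIV)"
    using measurable_compose[OF snd2 measurable_fst] by simp
  show "noise S \<in> borel_measurable (prob_of S)"
    using measurable_compose[OF snd3 measurable_fst] by simp
  show "interference S \<in> borel_measurable (prob_of S)"
    using measurable_compose[OF snd3 measurable_snd] by simp
  show "fading_h S \<in> borel_measurable (prob_of S)" "fading_g S \<in> borel_measurable (prob_of S)"
    using fading_indep by (simp_all add: indep_triple_def)
qed

lemma sets_given_idle [measurable_cong]: "sets (given_idle_state S j) = sets (prob_of S)"
  by (simp add: given_idle_state_def)

lemma space_given_idle: "space (given_idle_state S j) = space (prob_of S)"
  by (simp add: given_idle_state_def)

lemma measurable_total_noise [measurable]: "total_noise S j \<in> borel_measurable (prob_of S)"
  unfolding total_noise_def by (cases j) simp_all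

lemma idle_event_pos: "idle_state_possible S j \<Longrightarrow> emeasure (prob_of S) (idle_event S j) \<noteq> 0"
  by (simp add: idle_state_possible_def emeasure_eq_measure)

lemma prob_space_given_idle: "idle_state_possible S j \<Longrightarrow> prob_space (given_idle_state S j)"
  unfolding given_idle_state_def
  by (intro prob_space_uniform_measure idle_event_pos) simp_all

text \<open>Adding the interference acts only on the last two coordinates of a product law and so
  keeps the index independent. For an active user the sum has the convolution as density, and
  convolution distributes over the mixture, adding the variances componentwise.\<close>

lemma total_noise_law:
  assumes j: "idle_state_possible S j"
  shows "distr (given_idle_state S j) (count_space UNIV \<Otimes>\<^sub>M borel) (\<lambda>\<omega>. (symbol_index S \<omega>, total_noise S j \<omega>)) =
    index_law S \<Otimes>\<^sub>M density lborel (\<lambda>z. ennreal (total_noise_density S j z))"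
proof -
  let ?K = "given_idle_state S j"
  interpret K: prob_space ?K by (rule prob_space_given_idle[OF j])
  let ?Nn = "density lborel (\<lambda>z. ennreal (cgauss_density ((sigma_noise S)\<^sup>2) z))"
  let ?Nw = "density lborel (\<lambda>z. ennreal (gauss_mixture_density (mix_number S) (mix_weight S) (mix_sigma S) z))"
  have Nn: "distr ?K borel (noise S) = ?Nn" and Nw: "distr ?K borel (interference S) = ?Nw"
    using distributed_distr_eq_density[OF noise_density[OF j]] distributed_distr_eq_density[OF interference_density[OF j]]
    by (simp_all cong: distr_cong)
  have pn: "prob_space ?Nn" and pw: "prob_space ?Nw"
    unfolding Nn[symmetric] Nw[symmetric] by (simp_all add: K.prob_space_distr)
  interpret Nn: prob_space ?Nn by fact
  interpret Nw: prob_space ?Nw by fact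
  have law: "index_law S \<Otimes>\<^sub>M (?Nn \<Otimes>\<^sub>M ?Nw) =
    distr ?K (count_space UNIV \<Otimes>\<^sub>M (borel \<Otimes>\<^sub>M borel)) (\<lambda>\<omega>. (symbol_index S \<omega>, noise S \<omega>, interference S \<omega>))"
    using indep_triple_distr[OF prob_space_given_idle[OF j] transmission_indep[OF j]]
    by (simp add: Nn Nw symbol_index_uniform[OF j])
  let ?add = "\<lambda>(n, w). n + (if j then w else 0 :: complex)"
  have [measurable]: "?add \<in> borel_measurable (borel \<Otimes>\<^sub>M borel)"
    by (cases j) simp_all
  have add: "distr (?Nn \<Otimes>\<^sub>M ?Nw) borel ?add = density lborel (\<lambda>z. ennreal (total_noise_density S j z))"
  proof (cases j)
    case False
    have "distr (?Nn \<Otimes>\<^sub>M ?Nw) borel ?add = distr (?Nn \<Otimes>\<^sub>M ?Nw) ?Nn fst"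
      using False by (intro distr_cong) auto
    also have "\<dots> = ?Nn"
      by (rule Nw.distr_pair_fst)
    finally show ?thesis
      using False by (simp add: total_noise_density_def noise_comps_def noise_weight_def noise_var_def)
  next
    case True
    have "distr (?Nn \<Otimes>\<^sub>M ?Nw) borel ?add = distr (?Nn \<Otimes>\<^sub>M ?Nw) borel (\<lambda>(x, y). x + y)"
      using True by simp
    also have "\<dots> = density lborel (\<lambda>x. \<integral>\<^sup>+y. ennreal (cgauss_density ((sigma_noise S)\<^sup>2) (x - y)) *
        ennreal (gauss_mixture_density (mix_number S) (mix_weight S) (mix_sigma S) y) \<partial>lborel)"
      by (rule distr_add_density[OF _ _ Nw.sigma_finite_measure_axioms]) measurable
    also have "\<dots> = density lborel (\<lambda>z. ennreal (total_noise_density S j z))"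
    proof (rule arg_cong[where f="density lborel"], rule ext)
      fix x
      have pos: "0 \<le> mix_weight S l * cgauss_density ((mix_sigma S l)\<^sup>2 + e) y" "0 \<le> cgauss_density ((mix_sigma S l)\<^sup>2 + e) y"
        if "l \<in> {1..mix_number S}" "0 \<le> e" for l e y
        using mix_weight_nonneg[OF that(1)] cgauss_density_pos[OF add_pos_nonneg[OF mix_var_pos[OF that(1)] that(2)], of y]
        by simp_all
      have "(\<integral>\<^sup>+y. ennreal (cgauss_density ((sigma_noise S)\<^sup>2) (x - y)) *
          ennreal (gauss_mixture_density (mix_number S) (mix_weight S) (mix_sigma S) y) \<partial>lborel) =
        (\<integral>\<^sup>+y. (\<Sum>l=1..mix_number S. ennreal (mix_weight S l) *
          (ennreal (cgauss_density ((sigma_noise S)\<^sup>2) (x - y)) * ennreal (cgauss_density ((mix_sigma S l)\<^sup>2) y))) \<partial>lborel)"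
        unfolding gauss_mixture_density_def
        by (subst ennreal_sum_mult)
          (use pos(2)[OF _ order_refl] mix_weight_nonneg in \<open>auto simp: sum_distrib_left ac_simps\<close>)
      also have "\<dots> = (\<Sum>l=1..mix_number S. ennreal (mix_weight S l) *
          ennreal (cgauss_density ((sigma_noise S)\<^sup>2 + (mix_sigma S l)\<^sup>2) x))"
        by (simp add: nn_integral_sum nn_integral_cmult cgauss_convolution[OF noise_var_pos mix_var_pos])
      also have "\<dots> = ennreal (total_noise_density S j x)"
        using True unfolding total_noise_density_def
        by (subst ennreal_sum_mult)
          (use pos(2)[OF _ zero_le_power2[of "sigma_noise S"]] mix_weight_nonneg in
            \<open>auto simp: noise_comps_def noise_weight_def noise_var_def add.commute\<close>)
      finally show "(\<integral>\<^sup>+y. ennreal (cgauss_density ((sigma_noise S)\<^sup>2) (x - y)) *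
        ennreal (gauss_mixture_density (mix_number S) (mix_weight S) (mix_sigma S) y) \<partial>lborel) =
        ennreal (total_noise_density S j x)" .
    qed
    finally show ?thesis .
  qed
  have "distr ?K (count_space UNIV \<Otimes>\<^sub>M borel) (\<lambda>\<omega>. (symbol_index S \<omega>, total_noise S j \<omega>)) =
      distr (index_law S \<Otimes>\<^sub>M (?Nn \<Otimes>\<^sub>M ?Nw)) (count_space UNIV \<Otimes>\<^sub>M borel) (\<lambda>(i, p). (i, ?add p))"
    unfolding law by (subst distr_distr) (auto simp: comp_def total_noise_def split_beta' intro!: distr_cong)
  also have "\<dots> = distr (index_law S) (count_space UNIV) (\<lambda>x. x) \<Otimes>\<^sub>M distr (?Nn \<Otimes>\<^sub>M ?Nw) borel ?add"
  proof (rule pair_measure_distr[symmetric])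
    have "prob_space (distr (?Nn \<Otimes>\<^sub>M ?Nw) borel ?add)"
      by (intro prob_space.prob_space_distr pair_prob_space.axioms prob_space_pair pn pw) simp
    then show "sigma_finite_measure (distr (?Nn \<Otimes>\<^sub>M ?Nw) borel ?add)"
      by (simp add: prob_space_imp_sigma_finite)
  qed simp_all
  also have "distr (index_law S) (count_space UNIV) (\<lambda>x. x) = index_law S"
    by (rule distr_id2) simp
  finally show ?thesis
    by (simp only: add)
qed

text \<open>The conditioning event belongs to the block of variables that is independent of
  \<open>h\<close> and \<open>g\<close>. Conditioning on it therefore leaves the laws of
  \<open>h\<close> and \<open>g\<close> unchanged and keeps them independent of the block. On
  rectangles this is the product formula divided by the probability of the event.\<close>

lemma joint_law:
  assumes j: "idle_state_possible S j"
  shows "distr (given_idle_state S j) (borel \<Otimes>\<^sub>M (borel \<Otimes>\<^sub>M (count_space UNIV \<Otimes>\<^sub>M borel)))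
      (\<lambda>\<omega>. (fading_g S \<omega>, fading_h S \<omega>, symbol_index S \<omega>, total_noise S j \<omega>)) =
    distr (prob_of S) borel (fading_g S) \<Otimes>\<^sub>M (distr (prob_of S) borel (fading_h S) \<Otimes>\<^sub>M
      (index_law S \<Otimes>\<^sub>M density lborel (\<lambda>z. ennreal (total_noise_density S j z))))"
proof -
  let ?K = "given_idle_state S j" and ?M = "prob_of S" and ?E = "idle_event S j"
  let ?T = "count_space UNIV \<Otimes>\<^sub>M count_space UNIV \<Otimes>\<^sub>M count_space UNIV \<Otimes>\<^sub>M borel \<Otimes>\<^sub>M (borel :: complex measure)"
  let ?X = "\<lambda>\<omega>. (active S \<omega>, busy S \<omega>, symbol_index S \<omega>, noise S \<omega>, interference S \<omega>)"
  let ?Y = "\<lambda>\<omega>. (symbol_index S \<omega>, total_noise S j \<omega>)"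
  let ?L = "distr ?K (borel \<Otimes>\<^sub>M (borel \<Otimes>\<^sub>M (count_space UNIV \<Otimes>\<^sub>M borel)))
      (\<lambda>\<omega>. (fading_g S \<omega>, fading_h S \<omega>, ?Y \<omega>))"
  interpret K: prob_space ?K by (rule prob_space_given_idle[OF j])
  have "distr ?M borel (fading_g S) \<Otimes>\<^sub>M (distr ?M borel (fading_h S) \<Otimes>\<^sub>M
      distr ?K (count_space UNIV \<Otimes>\<^sub>M borel) ?Y) = ?L"
  proof (rule pair_measure_triple_eqI)
    show "prob_space (distr ?M borel (fading_g S))" "prob_space (distr ?M borel (fading_h S))"
      by (simp_all add: prob_space_distr)
    show "prob_space (distr ?K (count_space UNIV \<Otimes>\<^sub>M borel) ?Y)"
      by (rule K.prob_space_distr) measurable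
    show "sets ?L = sets (distr ?M borel (fading_g S) \<Otimes>\<^sub>M (distr ?M borel (fading_h S) \<Otimes>\<^sub>M
      distr ?K (count_space UNIV \<Otimes>\<^sub>M borel) ?Y))"
      by (simp cong: sets_pair_measure_cong)
  next
    fix A B C
    assume "A \<in> sets (distr ?M borel (fading_g S))" "B \<in> sets (distr ?M borel (fading_h S))"
      "C \<in> sets (distr ?K (count_space UNIV \<Otimes>\<^sub>M borel) ?Y)"
    then have A[measurable]: "A \<in> sets borel" and B[measurable]: "B \<in> sets borel"
      and C[measurable]: "C \<in> sets (count_space UNIV \<Otimes>\<^sub>M borel)" by simp_all
    \<comment> \<open>The conditioning event and the event \<open>C\<close> for index and noise,
      expressed as one set of values of the whole block, so that the unconditional independence
      applies.\<close>
    define C' where "C' = {x \<in> space ?T. \<not> fst (snd x) \<and> fst x = j \<and>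
      (fst (snd (snd x)), fst (snd (snd (snd x))) + (if j then snd (snd (snd (snd x))) else 0)) \<in> C}"
    have [measurable]: "C' \<in> sets ?T"
      unfolding C'_def by (cases j) measurable
    have unif: "emeasure ?K V = emeasure ?M (?E \<inter> V) / emeasure ?M ?E" if "V \<in> sets ?M" for V
      using that unfolding given_idle_state_def by (intro emeasure_uniform_measure) simp_all
    have C'_iff: "?X \<omega> \<in> C' \<longleftrightarrow> \<omega> \<in> ?E \<and> ?Y \<omega> \<in> C" if "\<omega> \<in> space ?M" for \<omega>
      using that by (auto simp: C'_def total_noise_def space_pair_measure)
    have X: "?X \<in> measurable ?M ?T"
      by measurable
    have YC: "emeasure (distr ?K (count_space UNIV \<Otimes>\<^sub>M borel) ?Y) C = emeasure (distr ?M ?T ?X) C' / emeasure ?M ?E"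
    proof -
      have "emeasure (distr ?K (count_space UNIV \<Otimes>\<^sub>M borel) ?Y) C = emeasure ?K (?Y -` C \<inter> space ?M)"
        by (subst emeasure_distr) (simp_all add: space_given_idle)
      also have "\<dots> = emeasure ?M (?E \<inter> (?Y -` C \<inter> space ?M)) / emeasure ?M ?E"
        by (rule unif) measurable
      also have "?E \<inter> (?Y -` C \<inter> space ?M) = ?X -` C' \<inter> space ?M"
        using C'_iff by blast
      finally show ?thesis
        using X by (simp add: emeasure_distr)
    qed
    have "emeasure ?L (A \<times> B \<times> C) = emeasure ?K {\<omega> \<in> space ?M. fading_g S \<omega> \<in> A \<and> fading_h S \<omega> \<in> B \<and> ?Y \<omega> \<in> C}"
      by (subst emeasure_distr) (auto simp: space_given_idle intro!: arg_cong[where f="emeasure ?K"])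
    also have "\<dots> = emeasure ?M (?E \<inter> {\<omega> \<in> space ?M. fading_g S \<omega> \<in> A \<and> fading_h S \<omega> \<in> B \<and> ?Y \<omega> \<in> C}) / emeasure ?M ?E"
      by (rule unif) measurable
    also have "?E \<inter> {\<omega> \<in> space ?M. fading_g S \<omega> \<in> A \<and> fading_h S \<omega> \<in> B \<and> ?Y \<omega> \<in> C} =
        {\<omega> \<in> space ?M. fading_h S \<omega> \<in> B \<and> fading_g S \<omega> \<in> A \<and> ?X \<omega> \<in> C'}"
      using C'_iff by blast
    also have "emeasure ?M \<dots> = emeasure (distr ?M borel (fading_h S)) B *
        (emeasure (distr ?M borel (fading_g S)) A * emeasure (distr ?M ?T ?X) C')"
      by (rule indep_triple_emeasure[OF prob_space_axioms fading_indep]) measurable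
    finally show "emeasure (distr ?M borel (fading_g S)) A * (emeasure (distr ?M borel (fading_h S)) B *
        emeasure (distr ?K (count_space UNIV \<Otimes>\<^sub>M borel) ?Y) C) = emeasure ?L (A \<times> B \<times> C)"
      by (simp add: YC divide_ennreal_def ac_simps)
  qed
  then show ?thesis
    by (simp add: total_noise_law[OF j])
qed

end

subsection \<open>Nearest-neighbour decisions\<close>

text \<open>Here \<open>x\<close> is the noise along one axis after equalisation and
  \<open>d\<close> the spacing. An end point of the row has no neighbour on its outer side, so noise
  in that direction is harmless.\<close>

definition pam_error :: "nat \<Rightarrow> real \<Rightarrow> nat \<Rightarrow> real \<Rightarrow> bool" where
  "pam_error M d n x \<longleftrightarrow> (n + 1 < M \<and> d / 2 < x) \<or> (0 < n \<and> x < - d / 2)"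

definition pam_neighbours :: "nat \<Rightarrow> nat \<Rightarrow> real" where
  "pam_neighbours M n = of_bool (n + 1 < M) + of_bool (0 < n)"

text \<open>Each of the \<open>M - 1\<close> gaps between adjacent points is counted once from
  either end.\<close>

lemma sum_pam_neighbours: "1 \<le> M \<Longrightarrow> (\<Sum>n<M. pam_neighbours M n) = 2 * (real M - 1)"
proof -
  assume "1 \<le> M"
  then obtain K where M: "M = Suc K" by (cases M) auto
  have "(\<Sum>n<Suc K. of_bool (n + 1 < Suc K) :: real) = (\<Sum>n<K. 1)"
    by (simp add: sum.lessThan_Suc)
  moreover have "(\<Sum>n<Suc K. of_bool (0 < n) :: real) = (\<Sum>n<K. 1)"
    by (subst sum.lessThan_Suc_shift) simp
  ultimately show ?thesis
    unfolding pam_neighbours_def M sum.distrib by simp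
qed

text \<open>The witness is the neighbour beyond the crossed threshold; one step changes the squared
  distance by \<open>d * (d - 2 * \<bar>x\<bar>)\<close>, which is negative.\<close>

lemma pam_error_closer:
  assumes "pam_error M d n x" "0 < d" "n < M"
  obtains m where "m < M" "(x + (real n - real m) * d)\<^sup>2 < x\<^sup>2"
proof -
  consider "n + 1 < M" "d / 2 < x" | "0 < n" "x < - d / 2"
    using assms(1) by (auto simp: pam_error_def)
  then show ?thesis
  proof cases
    case 1
    then have "0 < d * (2 * x - d)"
      using assms(2) by (intro mult_pos_pos) auto
    then have "(x + (real n - real (n + 1)) * d)\<^sup>2 < x\<^sup>2"
      by (simp add: power2_eq_square algebra_simps)
    with 1 that show ?thesis by blast
  next
    case 2
    then have "0 < d * (- 2 * x - d)"
      using assms(2) by (intro mult_pos_pos) auto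
    then have "(x + (real n - real (n - 1)) * d)\<^sup>2 < x\<^sup>2"
      using 2 by (simp add: power2_eq_square algebra_simps of_nat_diff)
    moreover have "n - 1 < M"
      using assms(3) by simp
    ultimately show ?thesis using that by blast
  qed
qed

text \<open>With \<open>k = n - m\<close> the gain in squared distance is
  \<open>d * k * (2 * x + k * d)\<close>. Since \<open>k\<close> is a nonzero integer and
  \<open>x\<close> stays strictly inside the threshold towards \<open>m\<close>, the last two
  factors have the same sign. Off the boundary values there are no ties.\<close>

lemma not_pam_error_farther:
  assumes "\<not> pam_error M d n x" "0 < d" "n < M" "m < M" "m \<noteq> n" "x \<noteq> d / 2" "x \<noteq> - d / 2"
  shows "x\<^sup>2 < (x + (real n - real m) * d)\<^sup>2"
proof -
  define k where "k = real n - real m"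
  have "0 < k * (2 * x + k * d)"
  proof (cases "n < m")
    case True
    then have "x < d / 2" "k \<le> - 1"
      using assms by (auto simp: pam_error_def k_def)
    moreover have "k * d \<le> - 1 * d"
      using \<open>k \<le> - 1\<close> assms(2) by (intro mult_right_mono) auto
    ultimately show ?thesis
      by (intro mult_neg_neg) auto
  next
    case False
    then have "- d / 2 < x" "1 \<le> k"
      using assms by (auto simp: pam_error_def k_def)
    moreover have "1 * d \<le> k * d"
      using \<open>1 \<le> k\<close> assms(2) by (intro mult_right_mono) auto
    ultimately show ?thesis
      by (intro mult_pos_pos) auto
  qed
  then have "0 < d * (k * (2 * x + k * d))"
    using assms(2) by simp
  then show ?thesis
    by (simp add: power2_eq_square algebra_simps flip: k_def)
qed

lemma qam_point_diff:
  "qam_point A B x i + w - qam_point A B x k =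
    Complex (Re w + (real (fst i) - real (fst k)) * qam_dmin A B x) (Im w + (real (snd i) - real (snd k)) * qam_dmin A B x)"
  by (simp add: qam_point_def complex_eq_iff) (simp add: algebra_simps diff_divide_distrib add_divide_distrib)

text \<open>Dividing by \<open>a\<close> scales all distances alike, and the squared distance is a
  sum over the two axes. Without a crossing every other point is strictly farther, whatever rule
  resolves ties; after a crossing, moving one index by one step already gives a closer
  point.\<close>

lemma nearest_point_error_iff:
  assumes d: "0 < qam_dmin A B x" and i: "i \<in> {..<A} \<times> {..<B}" and a: "a \<noteq> 0"
    and c: "c \<in> qam_constellation A B x"
    and min: "\<And>s. s \<in> qam_constellation A B x \<Longrightarrow>
      cmod (a * qam_point A B x i + z - a * c) \<le> cmod (a * qam_point A B x i + z - a * s)"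
    and bd: "Re (z / a) \<noteq> qam_dmin A B x / 2" "Re (z / a) \<noteq> - qam_dmin A B x / 2"
      "Im (z / a) \<noteq> qam_dmin A B x / 2" "Im (z / a) \<noteq> - qam_dmin A B x / 2"
  shows "c \<noteq> qam_point A B x i \<longleftrightarrow>
    pam_error A (qam_dmin A B x) (fst i) (Re (z / a)) \<or> pam_error B (qam_dmin A B x) (snd i) (Im (z / a))"
proof -
  let ?p = "qam_point A B x" and ?d = "qam_dmin A B x"
  define w where "w = z / a"
  have scale: "cmod (a * ?p i + z - a * s) = cmod a * cmod (?p i + w - s)" for s
  proof -
    have "a * ?p i + z - a * s = a * (?p i + w - s)"
      using a by (simp add: w_def algebra_simps)
    then show ?thesis by (simp only: norm_mult)
  qed
  have near: "cmod (?p i + w - c) \<le> cmod (?p i + w - ?p k)" if "k \<in> {..<A} \<times> {..<B}" for k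
    using min[of "?p k"] that a by (auto simp: scale qam_constellation_def)
  have sq: "(cmod (?p i + w - ?p k))\<^sup>2 =
      (Re w + (real (fst i) - real (fst k)) * ?d)\<^sup>2 + (Im w + (real (snd i) - real (snd k)) * ?d)\<^sup>2" for k
    unfolding qam_point_diff by (simp add: cmod_def)
  show ?thesis
    unfolding w_def[symmetric]
  proof
    assume ne: "c \<noteq> ?p i"
    from c obtain k where k: "k \<in> {..<A} \<times> {..<B}" "c = ?p k"
      by (auto simp: qam_constellation_def)
    with ne have "k \<noteq> i" by auto
    show "pam_error A ?d (fst i) (Re w) \<or> pam_error B ?d (snd i) (Im w)"
    proof (rule ccontr)
      assume no: "\<not> ?thesis"
      have I: "fst k \<noteq> fst i \<Longrightarrow> (Re w)\<^sup>2 < (Re w + (real (fst i) - real (fst k)) * ?d)\<^sup>2"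
        using no d i k bd by (intro not_pam_error_farther[of A]) (auto simp: w_def)
      have Q: "snd k \<noteq> snd i \<Longrightarrow> (Im w)\<^sup>2 < (Im w + (real (snd i) - real (snd k)) * ?d)\<^sup>2"
        using no d i k bd by (intro not_pam_error_farther[of B]) (auto simp: w_def)
      have "(cmod (?p i + w - ?p i))\<^sup>2 < (cmod (?p i + w - ?p k))\<^sup>2"
        unfolding sq using I Q \<open>k \<noteq> i\<close> by (cases "fst k = fst i"; cases "snd k = snd i") (auto simp: prod_eq_iff)
      then show False
        using near[OF i] k by (simp add: power2_less_imp_less not_less[symmetric] power_mono)
    qed
  next
    assume err: "pam_error A ?d (fst i) (Re w) \<or> pam_error B ?d (snd i) (Im w)"
    have "\<exists>k\<in>{..<A} \<times> {..<B}. (cmod (?p i + w - ?p k))\<^sup>2 < (cmod (?p i + w - ?p i))\<^sup>2"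
      using err
    proof
      assume "pam_error A ?d (fst i) (Re w)"
      then obtain m where "m < A" "(Re w + (real (fst i) - real m) * ?d)\<^sup>2 < (Re w)\<^sup>2"
        using d i by (auto elim!: pam_error_closer)
      then show ?thesis
        unfolding sq using i by (intro bexI[of _ "(m, snd i)"]) auto
    next
      assume "pam_error B ?d (snd i) (Im w)"
      then obtain m where "m < B" "(Im w + (real (snd i) - real m) * ?d)\<^sup>2 < (Im w)\<^sup>2"
        using d i by (auto elim!: pam_error_closer)
      then show ?thesis
        unfolding sq using i by (intro bexI[of _ "(fst i, m)"]) auto
    qed
    then obtain k where k: "k \<in> {..<A} \<times> {..<B}" "(cmod (?p i + w - ?p k))\<^sup>2 < (cmod (?p i + w - ?p i))\<^sup>2"
      by blast
    from k(2) have "cmod (?p i + w - ?p k) < cmod (?p i + w - ?p i)"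
      by (rule power2_less_imp_less) simp
    with near[OF k(1)] show "c \<noteq> ?p i" by auto
  qed
qed

lemma measurable_qam_point [measurable (raw)]:
  assumes i: "i \<in> measurable M (count_space UNIV)" and [measurable]: "p \<in> borel_measurable M"
  shows "(\<lambda>x. qam_point A B (p x) (i x)) \<in> borel_measurable M"
proof -
  have [measurable]: "(\<lambda>x. real (fst (i x))) \<in> borel_measurable M" "(\<lambda>x. real (snd (i x))) \<in> borel_measurable M"
    using measurable_compose[OF i, of "\<lambda>k. real (fst k)" borel] measurable_compose[OF i, of "\<lambda>k. real (snd k)" borel]
    by simp_all
  show ?thesis
    unfolding qam_point_def qam_dmin_def by measurable
qed

lemma AE_pair_prob_space:
  assumes "prob_space M" "prob_space N" "AE x in M \<Otimes>\<^sub>M N. P x"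
  shows "AE x in M. AE y in N. P (x, y)"
  using assms by (intro pair_sigma_finite.AE_pair pair_sigma_finite.intro prob_space_imp_sigma_finite)

lemma cgauss_density_strict_antimono:
  assumes "0 < v" "cmod z < cmod z'"
  shows "cgauss_density v z' < cgauss_density v z"
proof -
  have "(cmod z)\<^sup>2 < (cmod z')\<^sup>2"
    using assms by (intro power_strict_mono) auto
  then show ?thesis
    using assms by (simp add: cgauss_density_def divide_strict_right_mono)
qed

context osa_model
begin

abbreviation "law_g \<equiv> distr (prob_of S) borel (fading_g S)"
abbreviation "law_h \<equiv> distr (prob_of S) borel (fading_h S)"
abbreviation "law_noise j \<equiv> density lborel (\<lambda>z. ennreal (total_noise_density S j z))"
abbreviation "indices \<equiv> {..<size_I S} \<times> {..<size_Q S}"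
abbreviation "point x i \<equiv> qam_point (size_I S) (size_Q S) x i"
abbreviation "dmin x \<equiv> qam_dmin (size_I S) (size_Q S) x"

lemma indices_nonempty: "indices \<noteq> {}"
  using size_I_pos size_Q_pos by (auto simp: lessThan_empty_iff)

lemma total_noise_density_pos: "0 < total_noise_density S j z"
proof -
  obtain l where l: "l \<in> noise_comps S j" "0 < noise_weight S j l"
    using noise_weight_pos by blast
  show ?thesis
    unfolding total_noise_density_def
    using l by (intro sum_pos2[OF _ l(1)] mult_pos_pos mult_nonneg_nonneg noise_weight_nonneg less_imp_le[OF cgauss_density_pos]
        cgauss_density_pos noise_var_gt_0) auto
qed

lemma total_noise_density_strict_antimono:
  assumes "cmod z < cmod z'"
  shows "total_noise_density S j z' < total_noise_density S j z"
proof -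
  obtain l where l: "l \<in> noise_comps S j" "0 < noise_weight S j l"
    using noise_weight_pos by blast
  note lt = cgauss_density_strict_antimono[OF noise_var_gt_0 assms]
  show ?thesis
    unfolding total_noise_density_def
    by (intro sum_strict_mono_ex1 ballI bexI[OF _ l(1)] mult_strict_left_mono l(2) lt[OF l(1)] mult_left_mono
        noise_weight_nonneg less_imp_le[OF lt]) simp_all
qed

lemma prob_space_law_noise: "prob_space (law_noise j)"
proof (rule prob_spaceI)
  have "emeasure (law_noise j) (space (law_noise j)) =
      (\<integral>\<^sup>+z. (\<Sum>l\<in>noise_comps S j. ennreal (noise_weight S j l) * ennreal (cgauss_density (noise_var S j l) z)) \<partial>lborel)"
    unfolding total_noise_density_def
    by (simp add: emeasure_density)
       (intro nn_integral_cong ennreal_sum_mult noise_weight_nonneg less_imp_le[OF cgauss_density_pos[OF noise_var_gt_0]])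
  also have "\<dots> = ennreal (\<Sum>l\<in>noise_comps S j. noise_weight S j l)"
    by (simp add: nn_integral_sum nn_integral_cmult nn_integral_cgauss_density noise_var_gt_0 noise_weight_nonneg)
  finally show "emeasure (law_noise j) (space (law_noise j)) = 1"
    by (simp add: noise_weight_sum)
qed

lemma nn_integral_total_noise_density: "(\<integral>\<^sup>+z. ennreal (total_noise_density S j z) \<partial>lborel) = 1"
  using prob_space.emeasure_space_1[OF prob_space_law_noise[of j]] by (simp add: emeasure_density)

lemma prob_space_laws: "prob_space law_g" "prob_space law_h"
  by (simp_all add: prob_space_distr)

lemma prob_space_index_noise: "prob_space (index_law S \<Otimes>\<^sub>M law_noise j)"
  by (intro prob_space_pair prob_space_law_noise prob_space_measure_pmf)

lemma prob_space_h_index_noise: "prob_space (law_h \<Otimes>\<^sub>M (index_law S \<Otimes>\<^sub>M law_noise j))"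
  by (intro prob_space_pair prob_space_laws prob_space_index_noise)

text \<open>The integral over \<open>g\<close> is outermost because the value of \<open>g\<close>
  fixes the power and with it the constellation; \<open>h\<close> and the index then fix the
  received point up to noise, which is left as a plane integral.\<close>

lemma joint_nn_integral:
  assumes j: "idle_state_possible S j"
    and \<phi>[measurable]: "\<phi> \<in> borel_measurable (borel \<Otimes>\<^sub>M (borel \<Otimes>\<^sub>M (count_space UNIV \<Otimes>\<^sub>M borel)))"
  shows "(\<integral>\<^sup>+\<omega>. \<phi> (fading_g S \<omega>, fading_h S \<omega>, symbol_index S \<omega>, total_noise S j \<omega>) \<partial>given_idle_state S j) =
    (\<integral>\<^sup>+b. \<integral>\<^sup>+a. \<integral>\<^sup>+i. \<integral>\<^sup>+z. ennreal (total_noise_density S j z) * \<phi> (b, a, i, z) \<partial>lborel \<partial>index_law S \<partial>law_h \<partial>law_g)"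
proof -
  interpret N: prob_space "law_noise j" by (rule prob_space_law_noise)
  interpret IN: prob_space "index_law S \<Otimes>\<^sub>M law_noise j" by (rule prob_space_index_noise)
  interpret HIN: prob_space "law_h \<Otimes>\<^sub>M (index_law S \<Otimes>\<^sub>M law_noise j)" by (rule prob_space_h_index_noise)
  have meas: "\<phi> \<in> borel_measurable (law_g \<Otimes>\<^sub>M (law_h \<Otimes>\<^sub>M (index_law S \<Otimes>\<^sub>M law_noise j)))"
    using \<phi> by (simp cong: measurable_cong_sets sets_pair_measure_cong)
  have "(\<integral>\<^sup>+\<omega>. \<phi> (fading_g S \<omega>, fading_h S \<omega>, symbol_index S \<omega>, total_noise S j \<omega>) \<partial>given_idle_state S j) =
      (\<integral>\<^sup>+x. \<phi> x \<partial>(law_g \<Otimes>\<^sub>M (law_h \<Otimes>\<^sub>M (index_law S \<Otimes>\<^sub>M law_noise j))))"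
    unfolding joint_law[OF j, symmetric] by (rule nn_integral_distr[symmetric]) measurable
  also have "\<dots> = (\<integral>\<^sup>+b. \<integral>\<^sup>+x. \<phi> (b, x) \<partial>(law_h \<Otimes>\<^sub>M (index_law S \<Otimes>\<^sub>M law_noise j)) \<partial>law_g)"
    by (rule HIN.nn_integral_fst[symmetric, OF meas])
  also have "\<dots> = (\<integral>\<^sup>+b. \<integral>\<^sup>+a. \<integral>\<^sup>+x. \<phi> (b, a, x) \<partial>(index_law S \<Otimes>\<^sub>M law_noise j) \<partial>law_h \<partial>law_g)"
    by (intro nn_integral_cong IN.nn_integral_fst[symmetric])
       (simp cong: measurable_cong_sets sets_pair_measure_cong)
  also have "\<dots> = (\<integral>\<^sup>+b. \<integral>\<^sup>+a. \<integral>\<^sup>+i. \<integral>\<^sup>+z. \<phi> (b, a, i, z) \<partial>law_noise j \<partial>index_law S \<partial>law_h \<partial>law_g)"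
    by (intro nn_integral_cong N.nn_integral_fst[symmetric])
       (simp cong: measurable_cong_sets sets_pair_measure_cong)
  also have "\<dots> = (\<integral>\<^sup>+b. \<integral>\<^sup>+a. \<integral>\<^sup>+i. \<integral>\<^sup>+z. ennreal (total_noise_density S j z) * \<phi> (b, a, i, z) \<partial>lborel \<partial>index_law S \<partial>law_h \<partial>law_g)"
    by (intro nn_integral_cong nn_integral_density) simp_all
  finally show ?thesis .
qed

section \<open>Versions of the conditional density of the received signal\<close>

lemma AE_given_idle_rx:
  "AE \<omega> in given_idle_state S j. rx_signal S P \<omega> = fading_h S \<omega> * tx_symbol S P \<omega> + total_noise S j \<omega>"
  unfolding given_idle_state_def
  by (rule AE_uniform_measureI) (auto simp: rx_signal_def total_noise_def)

text \<open>The shifted noise density satisfies the same defining equation as \<open>f\<close>, so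
  the two agree almost everywhere for the law of (symbol, \<open>h\<close>) times Lebesgue measure.
  Pulling this back to \<open>g\<close>, \<open>h\<close> and the index turns the exceptional set
  into null sets of \<open>g\<close> and \<open>h\<close> alone, as every index has positive
  probability.\<close>

lemma cond_density_rx_AE:
  assumes j: "idle_state_possible S j" and \<pi>[measurable]: "\<pi> \<in> borel_measurable borel"
    and f: "cond_density_rx S (\<lambda>\<omega>. \<pi> (fading_g S \<omega>)) j f"
  shows "AE b in law_g. AE a in law_h. \<forall>i\<in>indices. AE y in lborel.
    f y (point (\<pi> b) i) a = total_noise_density S j (y - a * point (\<pi> b) i)"
proof -
  let ?K = "given_idle_state S j" and ?P = "\<lambda>\<omega>. \<pi> (fading_g S \<omega>)"
  interpret K: prob_space ?K by (rule prob_space_given_idle[OF j])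
  interpret N: prob_space "law_noise j" by (rule prob_space_law_noise)
  have tx[measurable]: "tx_symbol S ?P \<in> borel_measurable ?K"
    unfolding tx_symbol_def by measurable
  have [measurable]: "total_noise S j \<in> borel_measurable ?K" "fading_h S \<in> borel_measurable ?K"
    "fading_g S \<in> borel_measurable ?K" "symbol_index S \<in> measurable ?K (count_space UNIV)"
    by measurable
  have rx[measurable]: "rx_signal S ?P \<in> borel_measurable ?K"
    unfolding rx_signal_def by measurable
  define D2 where "D2 = distr ?K (borel \<Otimes>\<^sub>M borel) (\<lambda>\<omega>. (tx_symbol S ?P \<omega>, fading_h S \<omega>))"
  have sets_D2[measurable_cong]: "sets D2 = sets (borel \<Otimes>\<^sub>M borel)"
    by (simp add: D2_def)
  interpret D2: prob_space D2
    unfolding D2_def by (rule K.prob_space_distr) measurable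
  interpret DL: pair_sigma_finite D2 lborel ..
  \<comment> \<open>The candidate density: total noise centred at \<open>h * s\<close>, where
    \<open>fst p\<close> is the pair of \<open>s\<close> and \<open>h\<close>.\<close>
  define G where "G = (\<lambda>p. ennreal (total_noise_density S j (snd p - snd (fst p) * fst (fst p))))"
  define F where "F = (\<lambda>((s, h), y). ennreal (f y s h))"
  have [measurable]: "G \<in> borel_measurable (D2 \<Otimes>\<^sub>M lborel)"
    unfolding G_def by measurable
  have F[measurable]: "F \<in> borel_measurable (D2 \<Otimes>\<^sub>M lborel)"
    and eqF: "distr ?K (D2 \<Otimes>\<^sub>M lborel) (\<lambda>\<omega>. ((tx_symbol S ?P \<omega>, fading_h S \<omega>), rx_signal S ?P \<omega>)) = density (D2 \<Otimes>\<^sub>M lborel) F"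
    using f unfolding cond_density_rx_def distributed_def D2_def F_def by auto
  have "density (D2 \<Otimes>\<^sub>M lborel) G = density (D2 \<Otimes>\<^sub>M lborel) F"
    unfolding eqF[symmetric]
  proof (rule measure_eqI)
    fix A assume "A \<in> sets (density (D2 \<Otimes>\<^sub>M lborel) G)"
    then have A: "A \<in> sets (D2 \<Otimes>\<^sub>M lborel)" by simp
    then have A'[measurable]: "A \<in> sets ((borel \<Otimes>\<^sub>M borel) \<Otimes>\<^sub>M borel)"
      by (simp add: sets_D2 cong: sets_pair_measure_cong)
    let ?\<phi> = "\<lambda>(b, a, i, z). indicator A ((point (\<pi> b) i, a), a * point (\<pi> b) i + z) :: ennreal"
    let ?\<gamma> = "\<lambda>s a. \<integral>\<^sup>+y. ennreal (total_noise_density S j (y - a * s)) * indicator A ((s, a), y) \<partial>lborel"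
    have "emeasure (density (D2 \<Otimes>\<^sub>M lborel) G) A = (\<integral>\<^sup>+p. \<integral>\<^sup>+y. G (p, y) * indicator A (p, y) \<partial>lborel \<partial>D2)"
      using A by (subst emeasure_density, simp, simp, subst lborel.nn_integral_fst[symmetric]) simp_all
    also have "\<dots> = (\<integral>\<^sup>+\<omega>. ?\<gamma> (tx_symbol S ?P \<omega>) (fading_h S \<omega>) \<partial>?K)"
      unfolding D2_def by (subst nn_integral_distr) (simp_all add: G_def split_beta')
    also have "\<dots> = (\<integral>\<^sup>+b. \<integral>\<^sup>+a. \<integral>\<^sup>+i. \<integral>\<^sup>+z. ennreal (total_noise_density S j z) * ?\<gamma> (point (\<pi> b) i) a \<partial>lborel \<partial>index_law S \<partial>law_h \<partial>law_g)"
      using joint_nn_integral[OF j, of "\<lambda>(b, a, i, z). ?\<gamma> (point (\<pi> b) i) a"] by (simp add: tx_symbol_def)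
    also have "\<dots> = (\<integral>\<^sup>+b. \<integral>\<^sup>+a. \<integral>\<^sup>+i. ?\<gamma> (point (\<pi> b) i) a \<partial>index_law S \<partial>law_h \<partial>law_g)"
      by (simp add: nn_integral_multc nn_integral_total_noise_density)
    also have "\<dots> = (\<integral>\<^sup>+b. \<integral>\<^sup>+a. \<integral>\<^sup>+i. \<integral>\<^sup>+z. ennreal (total_noise_density S j z) * ?\<phi> (b, a, i, z) \<partial>lborel \<partial>index_law S \<partial>law_h \<partial>law_g)"
    proof (rule nn_integral_cong, rule nn_integral_cong, rule nn_integral_cong)
      fix b a i
      show "?\<gamma> (point (\<pi> b) i) a = (\<integral>\<^sup>+z. ennreal (total_noise_density S j z) * ?\<phi> (b, a, i, z) \<partial>lborel)"
        using nn_integral_lborel_translate[of "\<lambda>y. ennreal (total_noise_density S j (y - a * point (\<pi> b) i)) *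
          indicator A ((point (\<pi> b) i, a), y)" "a * point (\<pi> b) i"] by simp
    qed
    also have "\<dots> = (\<integral>\<^sup>+\<omega>. ?\<phi> (fading_g S \<omega>, fading_h S \<omega>, symbol_index S \<omega>, total_noise S j \<omega>) \<partial>?K)"
      by (rule joint_nn_integral[OF j, symmetric]) measurable
    also have "\<dots> = (\<integral>\<^sup>+\<omega>. indicator A ((tx_symbol S ?P \<omega>, fading_h S \<omega>), rx_signal S ?P \<omega>) \<partial>?K)"
      by (rule nn_integral_cong_AE, rule AE_mp[OF AE_given_idle_rx[where j=j and P="?P"]]) (simp add: tx_symbol_def)
    also have "\<dots> = (\<integral>\<^sup>+p. indicator A p \<partial>distr ?K (D2 \<Otimes>\<^sub>M lborel) (\<lambda>\<omega>. ((tx_symbol S ?P \<omega>, fading_h S \<omega>), rx_signal S ?P \<omega>)))"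
      using A by (subst nn_integral_distr) simp_all
    also have "\<dots> = emeasure (distr ?K (D2 \<Otimes>\<^sub>M lborel) (\<lambda>\<omega>. ((tx_symbol S ?P \<omega>, fading_h S \<omega>), rx_signal S ?P \<omega>))) A"
      using A by simp
    finally show "emeasure (density (D2 \<Otimes>\<^sub>M lborel) G) A = \<dots>" .
  qed simp
  then have "AE p in D2 \<Otimes>\<^sub>M lborel. G p = F p"
    by (subst (asm) DL.density_unique_iff) simp_all
  then have AE_D2: "AE p in D2. AE y in lborel. G (p, y) = F (p, y)"
    by (rule DL.AE_pair)
  \<comment> \<open>The pair of symbol and \<open>h\<close> as a function of the independent
    variables; it identifies \<open>D2\<close> as an image of their product law, along which null
    sets pull back.\<close>
  define T :: "complex \<times> complex \<times> (nat \<times> nat) \<times> complex \<Rightarrow> complex \<times> complex"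
    where "T x = (point (\<pi> (fst x)) (fst (snd (snd x))), fst (snd x))" for x
  let ?J = "law_g \<Otimes>\<^sub>M (law_h \<Otimes>\<^sub>M (index_law S \<Otimes>\<^sub>M law_noise j))"
  have [measurable]: "T \<in> measurable (borel \<Otimes>\<^sub>M (borel \<Otimes>\<^sub>M (count_space UNIV \<Otimes>\<^sub>M borel))) (borel \<Otimes>\<^sub>M borel)"
    unfolding T_def by measurable
  have D2_eq: "D2 = distr ?J (borel \<Otimes>\<^sub>M borel) T"
    unfolding D2_def joint_law[OF j, symmetric] by (subst distr_distr) (simp_all add: comp_def tx_symbol_def T_def)
  have "AE x in distr ?J (borel \<Otimes>\<^sub>M borel) T. AE y in lborel. G (x, y) = F (x, y)"
    using AE_D2 unfolding D2_eq .
  moreover have "T \<in> measurable ?J (borel \<Otimes>\<^sub>M borel)"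
    by measurable
  ultimately have "AE x in ?J. AE y in lborel. G (T x, y) = F (T x, y)"
    by (rule AE_distrD[rotated])
  then have "AE b in law_g. AE x in law_h \<Otimes>\<^sub>M (index_law S \<Otimes>\<^sub>M law_noise j). AE y in lborel. G (T (b, x), y) = F (T (b, x), y)"
    by (rule AE_pair_prob_space[OF prob_space_laws(1) prob_space_h_index_noise])
  then show ?thesis
  proof eventually_elim
    case (elim b)
    then have "AE a in law_h. AE x in index_law S \<Otimes>\<^sub>M law_noise j. AE y in lborel. G (T (b, a, x), y) = F (T (b, a, x), y)"
      by (rule AE_pair_prob_space[OF prob_space_laws(2) prob_space_index_noise])
    then show ?case
    proof eventually_elim
      case (elim a)
      then have "AE i in index_law S. AE z in law_noise j. AE y in lborel. G (T (b, a, i, z), y) = F (T (b, a, i, z), y)"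
        by (rule AE_pair_prob_space[OF prob_space_measure_pmf prob_space_law_noise])
      then have *: "\<forall>i\<in>indices. AE y in lborel. G ((point (\<pi> b) i, a), y) = F ((point (\<pi> b) i, a), y)"
        using indices_nonempty by (simp add: T_def N.AE_const AE_measure_pmf_iff)
      show ?case
      proof
        fix i assume "i \<in> indices"
        with * have "AE y in lborel. G ((point (\<pi> b) i, a), y) = F ((point (\<pi> b) i, a), y)" by blast
        then show "AE y in lborel. f y (point (\<pi> b) i) a = total_noise_density S j (y - a * point (\<pi> b) i)"
        proof eventually_elim
          case (elim y)
          \<comment> \<open>A negative value of \<open>f\<close> would also be sent to 0 by
            \<open>ennreal\<close>; strict positivity of the noise density rules this out, so the
            real values agree.\<close>
          have "0 < total_noise_density S j (y - a * point (\<pi> b) i)"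
            by (rule total_noise_density_pos)
          moreover have "ennreal (f y (point (\<pi> b) i) a) = ennreal (total_noise_density S j (y - a * point (\<pi> b) i))"
            using elim by (simp add: G_def F_def)
          ultimately show ?case
            by (metis ennreal_neg ennreal_inj ennreal_eq_0_iff less_eq_real_def not_le)
        qed
      qed
    qed
  qed
qed

subsection \<open>The error event\<close>

lemma posterior_sum: "posterior S False + posterior S True = 1"
proof -
  have eq: "{\<omega> \<in> space (prob_of S). \<not> busy S \<omega>} =
      {\<omega> \<in> space (prob_of S). active S \<omega> = False \<and> \<not> busy S \<omega>} \<union> {\<omega> \<in> space (prob_of S). active S \<omega> = True \<and> \<not> busy S \<omega>}"
    by auto
  have "prob {\<omega> \<in> space (prob_of S). \<not> busy S \<omega>} =
      prob {\<omega> \<in> space (prob_of S). active S \<omega> = False \<and> \<not> busy S \<omega>} +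
      prob {\<omega> \<in> space (prob_of S). active S \<omega> = True \<and> \<not> busy S \<omega>}"
    by (subst eq, rule finite_measure_Union) auto
  then show ?thesis
    using idle_pos unfolding posterior_def cond_prob_def by (simp flip: add_divide_distrib)
qed

lemma posterior_nonneg: "0 \<le> posterior S j"
  by (simp add: posterior_def cond_prob_def)

lemma posterior_impossible: "\<not> idle_state_possible S j \<Longrightarrow> posterior S j = 0"
  using measure_nonneg[of "prob_of S" "idle_event S j"]
  by (simp add: posterior_def cond_prob_def idle_state_possible_def conj_commute)

text \<open>There are finitely many indices, so for almost every \<open>y\<close> the chosen
  versions agree with the noise densities at all constellation points at once. A strictly farther
  point then has a strictly smaller weighted density, hence cannot be a maximizer.\<close>

lemma detector_nearest:
  assumes \<pi>[measurable]: "\<pi> \<in> borel_measurable borel" and pos: "\<And>b. 0 < \<pi> b"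
    and det: "MAP_detector S (\<lambda>\<omega>. \<pi> (fading_g S \<omega>)) detect"
  shows "AE b in law_g. AE a in law_h. AE y in lborel.
    detect a (\<pi> b) y \<in> qam_constellation (size_I S) (size_Q S) (\<pi> b) \<and>
    (\<forall>s\<in>qam_constellation (size_I S) (size_Q S) (\<pi> b). cmod (y - a * detect a (\<pi> b) y) \<le> cmod (y - a * s))"
proof -
  let ?C = "qam_constellation (size_I S) (size_Q S)"
  obtain f where f: "\<And>j. idle_state_possible S j \<Longrightarrow> cond_density_rx S (\<lambda>\<omega>. \<pi> (fading_g S \<omega>)) j (f j)"
    and max: "\<And>h x y. x > 0 \<Longrightarrow> is_arg_max (\<lambda>s. posterior S False * f False y s h + posterior S True * f True y s h)
      (\<lambda>s. s \<in> ?C x) (detect h x y)"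
    using det unfolding MAP_detector_def by blast
  \<comment> \<open>The guard is there because nothing is known about the version of an impossible
    state; its posterior, being 0, removes it from the objective.\<close>
  let ?ok = "\<lambda>j b a i y. idle_state_possible S j \<longrightarrow> f j y (point (\<pi> b) i) a = total_noise_density S j (y - a * point (\<pi> b) i)"
  have "AE b in law_g. AE a in law_h. \<forall>i\<in>indices. AE y in lborel. ?ok j b a i y" for j
  proof (cases "idle_state_possible S j")
    case True
    then show ?thesis
      using cond_density_rx_AE[OF True \<pi> f[OF True]] by simp
  qed simp
  from this[of False] this[of True] show ?thesis
  proof eventually_elim
    case (elim b)
    then show ?case
    proof eventually_elim
      case (elim a)
      then have "AE y in lborel. \<forall>i\<in>indices. ?ok False b a i y \<and> ?ok True b a i y"
        by (intro AE_finite_allI) auto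
      then show ?case
      proof eventually_elim
        case (elim y)
        let ?\<Phi> = "\<lambda>s. posterior S False * total_noise_density S False (y - a * s) +
          posterior S True * total_noise_density S True (y - a * s)"
        have post: "posterior S j * f j y s a = posterior S j * total_noise_density S j (y - a * s)" if "s \<in> ?C (\<pi> b)" for s j
          using that elim posterior_impossible[of j] by (cases j) (auto simp: qam_constellation_def)
        have D: "detect a (\<pi> b) y \<in> ?C (\<pi> b)"
          and best: "\<not> ?\<Phi> (detect a (\<pi> b) y) < ?\<Phi> s" if "s \<in> ?C (\<pi> b)" for s
          using max[OF pos[of b], of y a] that unfolding is_arg_max_def by (auto simp: post)
        show ?case
        proof (intro conjI ballI)
          show "detect a (\<pi> b) y \<in> ?C (\<pi> b)"
            using max[OF pos[of b], of y a] by (simp add: is_arg_max_def)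
          fix s assume s: "s \<in> ?C (\<pi> b)"
          show "cmod (y - a * detect a (\<pi> b) y) \<le> cmod (y - a * s)"
          proof (rule ccontr)
            assume "\<not> ?thesis"
            then have lt: "total_noise_density S j (y - a * detect a (\<pi> b) y) < total_noise_density S j (y - a * s)" for j
              by (intro total_noise_density_strict_antimono) simp
            have "?\<Phi> (detect a (\<pi> b) y) < ?\<Phi> s"
            \<comment> \<open>Strictness needs one positive posterior: if that of the idle state
              vanishes, the other is 1.\<close>
            proof (cases "posterior S False = 0")
              case True
              then show ?thesis
                using posterior_sum lt by simp
            next
              case False
              then have "0 < posterior S False"
                using posterior_nonneg[of False] by simp
              then show ?thesis
                using lt by (intro add_less_le_mono mult_strict_left_mono mult_left_mono posterior_nonneg) (auto intro: less_imp_le)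
            qed
            with best[OF s] show False by simp
          qed
        qed
      qed
    qed
  qed
qed

lemma size_denominator_pos: "0 < (real (size_I S))\<^sup>2 + (real (size_Q S))\<^sup>2 - 2"
proof -
  have "1 < size_I S \<or> 1 < size_Q S"
    using size_ge_2 size_I_pos size_Q_pos by (cases "size_I S = 1"; cases "size_Q S = 1") auto
  moreover have "1 \<le> (real (size_I S))\<^sup>2" "1 \<le> (real (size_Q S))\<^sup>2"
    using size_I_pos size_Q_pos by (simp_all add: one_le_power)
  moreover have "1 < (real n)\<^sup>2" if "1 < n" for n
    using that by (simp add: one_less_power)
  ultimately have "1 < (real (size_I S))\<^sup>2 \<or> 1 < (real (size_Q S))\<^sup>2"
    "1 \<le> (real (size_I S))\<^sup>2" "1 \<le> (real (size_Q S))\<^sup>2"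
    by blast+
  then show ?thesis by linarith
qed

lemma dmin_pos: "0 < x \<Longrightarrow> 0 < dmin x"
  using size_denominator_pos by (simp add: qam_dmin_def)

abbreviation "error_at a x i z \<equiv> pam_error (size_I S) (dmin x) (fst i) (Re (z / a)) \<or>
  pam_error (size_Q S) (dmin x) (snd i) (Im (z / a))"

text \<open>The error probability of nearest-point detection given the state, the fading value
  \<open>a\<close> and the power \<open>x\<close>. As no detector occurs in it, every MAP detector
  leads to the same kernel.\<close>

abbreviation "err_kernel j a x \<equiv> \<integral>\<^sup>+i. \<integral>\<^sup>+z. ennreal (total_noise_density S j z) *
  indicator {z. error_at a x i z} z \<partial>lborel \<partial>index_law S"

lemma AE_off_decision_boundary:
  assumes "a \<noteq> 0"
  shows "AE z in lborel. Re (z / a) \<noteq> t \<and> Im (z / a) \<noteq> t"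
proof -
  have eq: "1 / a * z = z / a" "- \<i> / a * z = - \<i> * (z / a)" for z
    by simp_all
  have rot: "Re (- \<i> * w) = Im w" for w
    by simp
  have "Re (1 / a * z) = Re (z / a)" "Re (- \<i> / a * z) = Im (z / a)" for z
    by (simp_all only: eq rot)
  with AE_lborel_Re_neq[of "1 / a" t] AE_lborel_Re_neq[of "- \<i> / a" t] show ?thesis
    using assms by auto
qed

text \<open>The exponential law of the squared modulus has no atom at 0, so division by
  \<open>h\<close> is harmless.\<close>

lemma law_h_nonzero:
  assumes "distributed (prob_of S) lborel (\<lambda>\<omega>. (cmod (fading_h S \<omega>))\<^sup>2) (\<lambda>x. ennreal (exponential_density 1 x))"
  shows "AE a in law_h. a \<noteq> 0"
proof -
  have "AE x in distr (prob_of S) lborel (\<lambda>\<omega>. (cmod (fading_h S \<omega>))\<^sup>2). x \<noteq> 0"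
    unfolding distributed_distr_eq_density[OF assms]
    using AE_lborel_singleton[of 0] by (subst AE_density) auto
  then have "AE \<omega> in prob_of S. (cmod (fading_h S \<omega>))\<^sup>2 \<noteq> 0"
    by (intro AE_distrD[of "\<lambda>\<omega>. (cmod (fading_h S \<omega>))\<^sup>2" "prob_of S" lborel]) auto
  then show ?thesis
    by (subst AE_distr_iff) auto
qed

definition symbol_error :: "('a \<Rightarrow> real) \<Rightarrow> (complex \<Rightarrow> real \<Rightarrow> complex \<Rightarrow> complex) \<Rightarrow> 'a set" where
  "symbol_error P detect =
    {\<omega> \<in> space (prob_of S). detect (fading_h S \<omega>) (P \<omega>) (rx_signal S P \<omega>) \<noteq> tx_symbol S P \<omega>}"

lemma measurable_detect:
  assumes det: "(\<lambda>(h, x, y). detect h x y) \<in> borel_measurable (borel \<Otimes>\<^sub>M borel \<Otimes>\<^sub>M borel)"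
    and [measurable]: "f \<in> borel_measurable M" "g \<in> borel_measurable M" "k \<in> borel_measurable M"
  shows "(\<lambda>x. detect (f x) (g x) (k x) :: complex) \<in> borel_measurable M"
  using measurable_compose[OF _ det, of "\<lambda>x. (f x, g x, k x)" M] by simp

lemma measurable_tx_rx [measurable (raw)]:
  assumes [measurable]: "P \<in> borel_measurable (prob_of S)"
  shows "tx_symbol S P \<in> borel_measurable (prob_of S)" "rx_signal S P \<in> borel_measurable (prob_of S)"
proof -
  show [measurable]: "tx_symbol S P \<in> borel_measurable (prob_of S)"
    unfolding tx_symbol_def by measurable
  show "rx_signal S P \<in> borel_measurable (prob_of S)"
    unfolding rx_signal_def by measurable
qed

lemma sets_symbol_error:
  assumes [measurable]: "P \<in> borel_measurable (prob_of S)"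
    and det: "(\<lambda>(h, x, y). detect h x y) \<in> borel_measurable (borel \<Otimes>\<^sub>M borel \<Otimes>\<^sub>M borel)"
  shows "symbol_error P detect \<in> sets (prob_of S)"
proof -
  have [measurable]: "(\<lambda>\<omega>. detect (fading_h S \<omega>) (P \<omega>) (rx_signal S P \<omega>)) \<in> borel_measurable (prob_of S)"
    by (intro measurable_detect[OF det]) measurable
  show ?thesis
    unfolding symbol_error_def by measurable
qed

text \<open>For almost every \<open>g\<close> and \<open>h\<close> the nearest-point property holds
  for almost every received \<open>y\<close>, and the decision boundaries are null sets. Under each
  index the error event and the threshold event then differ by a null set of noise values.\<close>

lemma symbol_error_given_idle:
  assumes j: "idle_state_possible S j"
    and \<pi>[measurable]: "\<pi> \<in> borel_measurable borel" and pos: "\<And>b. 0 < \<pi> b"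
    and det: "MAP_detector S (\<lambda>\<omega>. \<pi> (fading_g S \<omega>)) detect"
    and h0: "AE a in law_h. a \<noteq> 0"
  shows "emeasure (given_idle_state S j) (symbol_error (\<lambda>\<omega>. \<pi> (fading_g S \<omega>)) detect) =
    (\<integral>\<^sup>+b. \<integral>\<^sup>+a. err_kernel j a (\<pi> b) \<partial>law_h \<partial>law_g)"
proof -
  let ?K = "given_idle_state S j" and ?P = "\<lambda>\<omega>. \<pi> (fading_g S \<omega>)"
  have d: "(\<lambda>(h, x, y). detect h x y) \<in> borel_measurable (borel \<Otimes>\<^sub>M borel \<Otimes>\<^sub>M borel)"
    using det by (simp add: MAP_detector_def)
  let ?wrong = "\<lambda>(b, a, i, z). detect a (\<pi> b) (a * point (\<pi> b) i + z) \<noteq> point (\<pi> b) i"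
  let ?\<phi> = "\<lambda>x. if ?wrong x then 1 else 0 :: ennreal"
  have "Measurable.pred (borel \<Otimes>\<^sub>M (borel \<Otimes>\<^sub>M (count_space UNIV \<Otimes>\<^sub>M borel))) ?wrong"
  proof -
    let ?N = "borel \<Otimes>\<^sub>M (borel \<Otimes>\<^sub>M (count_space UNIV \<Otimes>\<^sub>M borel)) :: (complex \<times> complex \<times> (nat \<times> nat) \<times> complex) measure"
    have [measurable]: "(\<lambda>x. detect (fst (snd x)) (\<pi> (fst x))
        (fst (snd x) * point (\<pi> (fst x)) (fst (snd (snd x))) + snd (snd (snd x)))) \<in> borel_measurable ?N"
      by (intro measurable_detect[OF d]) measurable
    show ?thesis
      unfolding split_beta' by measurable
  qed
  then have \<phi>[measurable]: "?\<phi> \<in> borel_measurable (borel \<Otimes>\<^sub>M (borel \<Otimes>\<^sub>M (count_space UNIV \<Otimes>\<^sub>M borel)))"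
    by measurable
  have "symbol_error ?P detect \<in> sets ?K"
    unfolding sets_given_idle by (intro sets_symbol_error d) measurable
  then have "emeasure ?K (symbol_error ?P detect) = (\<integral>\<^sup>+\<omega>. indicator (symbol_error ?P detect) \<omega> \<partial>?K)"
    by simp
  also have "\<dots> = (\<integral>\<^sup>+\<omega>. ?\<phi> (fading_g S \<omega>, fading_h S \<omega>, symbol_index S \<omega>, total_noise S j \<omega>) \<partial>?K)"
    by (rule nn_integral_cong_AE, rule AE_mp[OF AE_given_idle_rx[where j=j and P="?P"]])
       (auto simp: symbol_error_def tx_symbol_def space_given_idle split: split_indicator)
  also have "\<dots> = (\<integral>\<^sup>+b. \<integral>\<^sup>+a. \<integral>\<^sup>+i. \<integral>\<^sup>+z. ennreal (total_noise_density S j z) * ?\<phi> (b, a, i, z) \<partial>lborel \<partial>index_law S \<partial>law_h \<partial>law_g)"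
    by (rule joint_nn_integral[OF j \<phi>])
  also have "\<dots> = (\<integral>\<^sup>+b. \<integral>\<^sup>+a. err_kernel j a (\<pi> b) \<partial>law_h \<partial>law_g)"
  proof (rule nn_integral_cong_AE, rule AE_mp[OF detector_nearest[OF \<pi> pos det]], intro AE_I2 impI, rule nn_integral_cong_AE)
    fix b
    let ?C = "qam_constellation (size_I S) (size_Q S) (\<pi> b)"
    assume "AE a in law_h. AE y in lborel. detect a (\<pi> b) y \<in> ?C \<and>
      (\<forall>s\<in>?C. cmod (y - a * detect a (\<pi> b) y) \<le> cmod (y - a * s))"
    with h0 show "AE a in law_h. (\<integral>\<^sup>+i. \<integral>\<^sup>+z. ennreal (total_noise_density S j z) * ?\<phi> (b, a, i, z) \<partial>lborel \<partial>index_law S) =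
      err_kernel j a (\<pi> b)"
    proof eventually_elim
      case (elim a)
      show ?case
      proof (rule nn_integral_cong_AE)
        have "(\<integral>\<^sup>+z. ennreal (total_noise_density S j z) * ?\<phi> (b, a, i, z) \<partial>lborel) =
          (\<integral>\<^sup>+z. ennreal (total_noise_density S j z) * indicator {z. error_at a (\<pi> b) i z} z \<partial>lborel)" if i: "i \<in> indices" for i
        proof (rule nn_integral_cong_AE)
          \<comment> \<open>The exceptional set of received signals is shifted by the transmitted
            point \<open>a * point (\<pi> b) i\<close> to become a null set of noise values.\<close>
          from AE_lborel_translate[OF elim(2), of "a * point (\<pi> b) i"]
            AE_off_decision_boundary[OF elim(1), of "dmin (\<pi> b) / 2"] AE_off_decision_boundary[OF elim(1), of "- dmin (\<pi> b) / 2"]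
          show "AE z in lborel. ennreal (total_noise_density S j z) * ?\<phi> (b, a, i, z) =
            ennreal (total_noise_density S j z) * indicator {z. error_at a (\<pi> b) i z} z"
          proof eventually_elim
            case (elim z)
            have "detect a (\<pi> b) (a * point (\<pi> b) i + z) \<noteq> point (\<pi> b) i \<longleftrightarrow> error_at a (\<pi> b) i z"
              using elim by (intro nearest_point_error_iff[OF dmin_pos[OF pos] i \<open>a \<noteq> 0\<close>]) auto
            then show ?case by simp
          qed
        qed
        then show "AE i in index_law S. (\<integral>\<^sup>+z. ennreal (total_noise_density S j z) * ?\<phi> (b, a, i, z) \<partial>lborel) =
          (\<integral>\<^sup>+z. ennreal (total_noise_density S j z) * indicator {z. error_at a (\<pi> b) i z} z \<partial>lborel)"
          using indices_nonempty by (simp add: AE_measure_pmf_iff)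
      qed
    qed
  qed
  finally show ?thesis .
qed

section \<open>Error probability for fixed fading and power\<close>

lemma noise_half_plane:
  assumes a: "a \<noteq> 0" and c: "cmod c = 1"
  shows "(\<integral>\<^sup>+z. ennreal (total_noise_density S j z) * indicator {z. t < Re (c * z / a)} z \<partial>lborel) =
    ennreal (\<Sum>l\<in>noise_comps S j. noise_weight S j l * gaussian_Q (t * cmod a / sqrt (noise_var S j l)))"
proof -
  have "(\<integral>\<^sup>+z. ennreal (total_noise_density S j z) * indicator {z. t < Re (c * z / a)} z \<partial>lborel) =
      (\<integral>\<^sup>+z. (\<Sum>l\<in>noise_comps S j. ennreal (noise_weight S j l) *
        (ennreal (cgauss_density (noise_var S j l) z) * indicator {z. t < Re (c * z / a)} z)) \<partial>lborel)"
    unfolding total_noise_density_def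
    by (intro nn_integral_cong, subst ennreal_sum_mult)
       (auto simp: sum_distrib_right mult.assoc intro: noise_weight_nonneg less_imp_le[OF cgauss_density_pos[OF noise_var_gt_0]])
  also have "\<dots> = (\<Sum>l\<in>noise_comps S j. ennreal (noise_weight S j l) * ennreal (gaussian_Q (t * cmod a / sqrt (noise_var S j l))))"
    by (subst nn_integral_sum)
       (simp_all add: nn_integral_cmult cgauss_half_plane[OF noise_var_gt_0 a c])
  finally show ?thesis
    by (simp add: ennreal_sum_mult noise_weight_nonneg gaussian_Q_nonneg)
qed

text \<open>The probability that the noise crosses one decision boundary, which lies at distance
  \<open>dmin x / 2 * cmod a\<close> in the received constellation.\<close>

abbreviation "noise_tail j a x \<equiv>
  \<Sum>l\<in>noise_comps S j. noise_weight S j l * gaussian_Q (dmin x / 2 * cmod a / sqrt (noise_var S j l))"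

lemma tail_nonneg: "0 \<le> noise_tail j a x"
  by (intro sum_nonneg mult_nonneg_nonneg noise_weight_nonneg gaussian_Q_nonneg)

text \<open>The factor \<open>c\<close> selects the coordinate: \<open>c = 1\<close> is the in-phase and \<open>c = -\<i>\<close> the quadrature part.\<close>

lemma pam_error_prob:
  assumes a: "a \<noteq> 0" and c: "cmod c = 1" and x: "0 < x"
  shows "(\<integral>\<^sup>+z. ennreal (total_noise_density S j z) * indicator {z. pam_error M (dmin x) n (Re (c * z / a))} z \<partial>lborel) =
    ennreal (pam_neighbours M n * noise_tail j a x)"
proof -
  \<comment> \<open>A downward crossing is an upward crossing for \<open>- c\<close>. The two events
    are disjoint because the spacing is positive, so their indicators add up.\<close>
  let ?up = "{z. dmin x / 2 < Re (c * z / a)}" and ?dn = "{z. dmin x / 2 < Re (- c * z / a)}"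
  let ?G = "\<lambda>z. ennreal (total_noise_density S j z)"
  have ind: "?G z * indicator {z. pam_error M (dmin x) n (Re (c * z / a))} z =
      of_bool (n + 1 < M) * (?G z * indicator ?up z) + of_bool (0 < n) * (?G z * indicator ?dn z)" for z
    using dmin_pos[OF x] by (auto simp: pam_error_def split: split_indicator)
  have "(\<integral>\<^sup>+z. ?G z * indicator {z. pam_error M (dmin x) n (Re (c * z / a))} z \<partial>lborel) =
      of_bool (n + 1 < M) * (\<integral>\<^sup>+z. ?G z * indicator ?up z \<partial>lborel) +
      of_bool (0 < n) * (\<integral>\<^sup>+z. ?G z * indicator ?dn z \<partial>lborel)"
    unfolding ind by (subst nn_integral_add) (simp_all add: nn_integral_cmult)
  also have "\<dots> = of_bool (n + 1 < M) * ennreal (noise_tail j a x) + of_bool (0 < n) * ennreal (noise_tail j a x)"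
    using noise_half_plane[OF a c, of j "dmin x / 2"] noise_half_plane[OF a, of "- c" j "dmin x / 2"] c by simp
  also have "\<dots> = ennreal (pam_neighbours M n * noise_tail j a x)"
    using tail_nonneg[of j x a] by (auto simp: pam_neighbours_def distrib_right simp flip: ennreal_plus)
  finally show ?thesis .
qed

lemma kernel_bound:
  assumes a: "a \<noteq> 0" and x: "0 < x"
  shows "err_kernel j a x \<le> ennreal (2 * (2 - 1 / real (size_I S) - 1 / real (size_Q S)) * noise_tail j a x)"
    and "size_Q S = 1 \<Longrightarrow> err_kernel j a x = ennreal (2 * (2 - 1 / real (size_I S) - 1 / real (size_Q S)) * noise_tail j a x)"
proof -
  let ?G = "\<lambda>z. ennreal (total_noise_density S j z)" and ?M = "size_I S" and ?N = "size_Q S"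
  let ?c = "\<lambda>i. pam_neighbours ?M (fst i) + pam_neighbours ?N (snd i)"
  let ?f = "\<lambda>i. \<integral>\<^sup>+z. ?G z * indicator {z. error_at a x i z} z \<partial>lborel"
  have I: "(\<integral>\<^sup>+z. ?G z * indicator {z. pam_error ?M (dmin x) n (Re (z / a))} z \<partial>lborel) = ennreal (pam_neighbours ?M n * noise_tail j a x)" for n
    using pam_error_prob[OF a _ x, of 1 j ?M n] by simp
  have Q: "(\<integral>\<^sup>+z. ?G z * indicator {z. pam_error ?N (dmin x) n (Im (z / a))} z \<partial>lborel) = ennreal (pam_neighbours ?N n * noise_tail j a x)" for n
  proof -
    have eq: "- \<i> * z / a = - \<i> * (z / a)" and rot: "Re (- \<i> * z) = Im z" for z
      by simp_all
    have "Re (- \<i> * z / a) = Im (z / a)" for z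
      by (simp only: eq rot)
    then show ?thesis
      using pam_error_prob[OF a _ x, of "- \<i>" j ?N n] by simp
  qed
  have nn: "0 \<le> pam_neighbours m n * noise_tail j a x" for m n
    by (intro mult_nonneg_nonneg tail_nonneg) (simp add: pam_neighbours_def)
  have pm: "Measurable.pred borel (\<lambda>z. pam_error m d n (Re (z / a)))" "Measurable.pred borel (\<lambda>z. pam_error m d n (Im (z / a)))" for m d n
    unfolding pam_error_def by measurable
  have le: "?f i \<le> ennreal (?c i * noise_tail j a x)" for i
  proof -
    have "?f i \<le> (\<integral>\<^sup>+z. ?G z * indicator {z. pam_error ?M (dmin x) (fst i) (Re (z / a))} z +
        ?G z * indicator {z. pam_error ?N (dmin x) (snd i) (Im (z / a))} z \<partial>lborel)"
      by (intro nn_integral_mono) (auto split: split_indicator)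
    also have "\<dots> = ennreal (pam_neighbours ?M (fst i) * noise_tail j a x) + ennreal (pam_neighbours ?N (snd i) * noise_tail j a x)"
      using pm by (subst nn_integral_add) (simp_all add: I Q)
    also have "\<dots> = ennreal (?c i * noise_tail j a x)"
      using nn by (simp add: distrib_right flip: ennreal_plus)
    finally show ?thesis .
  qed
  \<comment> \<open>With a single row the quadrature index is 0 and has no neighbour on either side,
    so the second alternative of the error event is empty and the union bound loses nothing.\<close>
  have eq: "?f i = ennreal (?c i * noise_tail j a x)" if "?N = 1" "i \<in> indices" for i
    using that I[of "fst i"] by (auto simp: pam_error_def pam_neighbours_def)
  have total: "(\<integral>\<^sup>+i. ennreal (?c i * noise_tail j a x) \<partial>index_law S) =
      ennreal (2 * (2 - 1 / real ?M - 1 / real ?N) * noise_tail j a x)"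
  proof -
    \<comment> \<open>The in-phase gaps recur in every row and the quadrature gaps in every column;
      division by the number of points turns this count into
      \<open>2 * (2 - 1 / M_I - 1 / M_Q)\<close>.\<close>
    have "(\<Sum>i\<in>indices. ?c i) = (\<Sum>n<?M. \<Sum>q<?N. pam_neighbours ?M n + pam_neighbours ?N q)"
      by (subst sum.cartesian_product) (simp add: split_beta')
    also have "\<dots> = real ?N * (2 * (real ?M - 1)) + real ?M * (2 * (real ?N - 1))"
      using size_I_pos size_Q_pos by (simp add: sum.distrib sum_pam_neighbours flip: sum_distrib_left)
    finally have s: "(\<Sum>i\<in>indices. ?c i) = \<dots>" .
    have "(\<integral>\<^sup>+i. ennreal (?c i * noise_tail j a x) \<partial>index_law S) = (\<Sum>i\<in>indices. ennreal (?c i * noise_tail j a x)) / of_nat (card indices)"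
      using indices_nonempty by (subst nn_integral_pmf_of_set) simp_all
    also have "(\<Sum>i\<in>indices. ennreal (?c i * noise_tail j a x)) = ennreal ((\<Sum>i\<in>indices. ?c i) * noise_tail j a x)"
      unfolding sum_distrib_right using nn by (intro sum_ennreal) (simp add: distrib_right)
    also have "\<dots> / of_nat (card indices) = ennreal ((\<Sum>i\<in>indices. ?c i) * noise_tail j a x / real (?M * ?N))"
      using size_I_pos size_Q_pos tail_nonneg[of j x a] unfolding s
      by (subst divide_ennreal[symmetric]) (auto simp: ennreal_of_nat_eq_real_of_nat card_cartesian_product)
    also have "(\<Sum>i\<in>indices. ?c i) * noise_tail j a x / real (?M * ?N) = 2 * (2 - 1 / real ?M - 1 / real ?N) * noise_tail j a x"
      using size_I_pos size_Q_pos unfolding s by (simp add: field_simps)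
    finally show ?thesis .
  qed
  show "err_kernel j a x \<le> ennreal (2 * (2 - 1 / real ?M - 1 / real ?N) * noise_tail j a x)"
    unfolding total[symmetric] by (intro nn_integral_mono le)
  show "err_kernel j a x = ennreal (2 * (2 - 1 / real ?M - 1 / real ?N) * noise_tail j a x)" if "?N = 1"
    unfolding total[symmetric] using eq[OF that] indices_nonempty
    by (intro nn_integral_cong_AE) (simp add: AE_measure_pmf_iff)
qed

end

subsection \<open>Averaging over the fading\<close>

lemma measurable_gaussian_Q [measurable]: "gaussian_Q \<in> borel_measurable borel"
proof (rule borel_measurable_continuous_onI)
  show "continuous_on UNIV gaussian_Q"
    using DERIV_gaussian_Q[OF DERIV_ident] by (intro continuous_at_imp_continuous_on ballI) (blast intro: DERIV_isCont)
qed

text \<open>Only the laws of the squared moduli of \<open>h\<close> and \<open>g\<close> are given,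
  not those of their phases. The integrands to be averaged depend on the moduli alone.\<close>

lemma distributed_distr_nn_integral:
  assumes X[measurable]: "X \<in> borel_measurable M" and [measurable]: "q \<in> borel_measurable borel"
    and d: "distributed M lborel (\<lambda>\<omega>. q (X \<omega>)) f" and [measurable]: "\<phi> \<in> borel_measurable borel"
  shows "(\<integral>\<^sup>+a. \<phi> (q a) \<partial>distr M borel X) = (\<integral>\<^sup>+x. f x * \<phi> x \<partial>lborel)"
proof -
  have "(\<integral>\<^sup>+a. \<phi> (q a) \<partial>distr M borel X) = (\<integral>\<^sup>+\<omega>. \<phi> (q (X \<omega>)) \<partial>M)"
    by (rule nn_integral_distr) measurable
  also have "\<dots> = (\<integral>\<^sup>+x. f x * \<phi> x \<partial>lborel)"
    using distributed_nn_integral[OF d, of \<phi>] by simp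
  finally show ?thesis .
qed

lemma one_minus_sqrt_fraction_nonneg:
  fixes \<psi> x :: real
  assumes "0 < \<psi>" "0 \<le> x"
  shows "0 \<le> 1 - sqrt (\<psi> / (x + \<psi>))"
  using assms by simp

definition sep_bracket :: "real \<Rightarrow> real \<Rightarrow> real" where
  "sep_bracket \<theta> \<psi> = exp (- \<theta>) - 2 * sqrt (\<psi> * pi) * exp \<psi> * gaussian_Q (sqrt (2 * (\<theta> + \<psi>)))"

text \<open>The limited power as a function of the value of \<open>g\<close>, ready for integration
  against its law. The separate value at 0 keeps the power positive everywhere, so the constellation
  never degenerates.\<close>

definition power_cap :: "real \<Rightarrow> real \<Rightarrow> complex \<Rightarrow> real" where
  "power_cap P Q b = (if b = 0 then P else min P (Q / (cmod b)\<^sup>2))"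

lemma power_cap_measurable [measurable]: "power_cap P Q \<in> borel_measurable borel"
  unfolding power_cap_def by measurable

lemma power_cap_pos: "0 < P \<Longrightarrow> 0 < Q \<Longrightarrow> 0 < power_cap P Q b"
  by (simp add: power_cap_def)

lemma power_cap_eq:
  assumes "0 < P" "0 < Q"
  shows "(cmod b)\<^sup>2 \<le> Q / P \<Longrightarrow> power_cap P Q b = P"
    and "Q / P < (cmod b)\<^sup>2 \<Longrightarrow> power_cap P Q b = Q / (cmod b)\<^sup>2"
proof -
  show "power_cap P Q b = P" if "(cmod b)\<^sup>2 \<le> Q / P"
    using that assms by (auto simp: power_cap_def min_def field_simps)
  assume *: "Q / P < (cmod b)\<^sup>2"
  moreover have "0 < Q / P" using assms by simp
  ultimately have b: "0 < (cmod b)\<^sup>2" by linarith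
  then have "Q / (cmod b)\<^sup>2 < P"
    using * assms by (simp add: field_simps)
  then show "power_cap P Q b = Q / (cmod b)\<^sup>2"
    using b by (auto simp: power_cap_def)
qed

lemma limited_power_eq: "limited_power S P Q = (\<lambda>\<omega>. power_cap P Q (fading_g S \<omega>))"
  by (simp add: limited_power_def power_cap_def fun_eq_iff)

context osa_model
begin

abbreviation "M_I \<equiv> real (size_I S)"
abbreviation "M_Q \<equiv> real (size_Q S)"
abbreviation "sep_factor \<equiv> 2 - 1 / M_I - 1 / M_Q"

text \<open>At power \<open>Q / r\<close> the ratio of \<open>(dmin / 2)^2\<close> to the noise
  variance of component \<open>l\<close> equals \<open>2 * sep_psi / r\<close>.\<close>

definition sep_psi :: "real \<Rightarrow> bool \<Rightarrow> nat \<Rightarrow> real" where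
  "sep_psi Q j l = 3 * Q / (2 * (M_I\<^sup>2 + M_Q\<^sup>2 - 2) * noise_var S j l)"

lemma sep_factor_nonneg: "0 \<le> sep_factor"
proof -
  have "1 / M_I \<le> 1" "1 / M_Q \<le> 1"
    using size_I_pos size_Q_pos by (simp_all add: field_simps)
  then show ?thesis by simp
qed

lemma sep_psi_pos: "0 < Q \<Longrightarrow> l \<in> noise_comps S j \<Longrightarrow> 0 < sep_psi Q j l"
  using size_denominator_pos noise_var_gt_0[of l j] by (simp add: sep_psi_def)

text \<open>Here \<open>r\<close> stands for the squared modulus of \<open>g\<close> where the
  interference limit is active. From \<open>(k l)^2 = 2 * \<psi> / r\<close> follows
  \<open>k / sqrt (k^2 + 2) = sqrt (\<psi> / (r + \<psi>))\<close>, and the \<open>1 / 2\<close> of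
  the Rayleigh average cancels the factor 2 of the neighbour count.\<close>

lemma average_noise_tail:
  assumes H: "distributed (prob_of S) lborel (\<lambda>\<omega>. (cmod (fading_h S \<omega>))\<^sup>2) (\<lambda>x. ennreal (exponential_density 1 x))"
    and Q: "0 < Q" and r: "0 < r"
  shows "(\<integral>\<^sup>+a. ennreal (2 * sep_factor * noise_tail j a (Q / r)) \<partial>law_h) =
    ennreal (sep_factor * (\<Sum>l\<in>noise_comps S j. noise_weight S j l * (1 - sqrt (sep_psi Q j l / (r + sep_psi Q j l)))))"
proof -
  define k where "k l = dmin (Q / r) / 2 / sqrt (noise_var S j l)" for l
  have x: "0 < Q / r" using Q r by simp
  have ratio: "2 * \<psi> / r / (2 * \<psi> / r + 2) = \<psi> / (r + \<psi>)" if "0 < \<psi>" "0 < r" for \<psi> r :: real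
    using that by (simp add: divide_simps)
  have k: "0 < k l" if "l \<in> noise_comps S j" for l
    using dmin_pos[OF x] noise_var_gt_0[OF that] by (simp add: k_def)
  have k_eq: "k l / sqrt ((k l)\<^sup>2 + 2) = sqrt (sep_psi Q j l / (r + sep_psi Q j l))" if l: "l \<in> noise_comps S j" for l
  proof -
    define D where "D = M_I\<^sup>2 + M_Q\<^sup>2 - 2"
    have D: "0 < D" using size_denominator_pos by (simp add: D_def)
    have "(dmin (Q / r))\<^sup>2 = 12 * (Q / r) / D"
      using Q r D unfolding qam_dmin_def D_def[symmetric] by (intro real_sqrt_pow2) simp
    then have "(k l)\<^sup>2 = 2 * sep_psi Q j l / r"
      using noise_var_gt_0[OF l] D r by (simp add: k_def power_divide sep_psi_def flip: D_def)
    then have "(k l)\<^sup>2 / ((k l)\<^sup>2 + 2) = sep_psi Q j l / (r + sep_psi Q j l)"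
      using ratio[OF sep_psi_pos[OF Q l] r] by simp
    then have "sqrt ((k l)\<^sup>2 / ((k l)\<^sup>2 + 2)) = sqrt (sep_psi Q j l / (r + sep_psi Q j l))"
      by simp
    then show ?thesis
      using k[OF l] by (simp add: real_sqrt_divide)
  qed
  have term_nonneg: "0 \<le> 1 - sqrt (sep_psi Q j l / (r + sep_psi Q j l))" if "l \<in> noise_comps S j" for l
    using r by (intro one_minus_sqrt_fraction_nonneg sep_psi_pos[OF Q that]) simp
  have "(\<integral>\<^sup>+a. ennreal (2 * sep_factor * noise_tail j a (Q / r)) \<partial>law_h) =
      (\<integral>\<^sup>+a. ennreal (2 * sep_factor) * (\<Sum>l\<in>noise_comps S j. ennreal (noise_weight S j l) * ennreal (gaussian_Q (k l * sqrt ((cmod a)\<^sup>2)))) \<partial>law_h)"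
  proof (rule nn_integral_cong)
    fix a
    have "ennreal (2 * sep_factor * noise_tail j a (Q / r)) = ennreal (2 * sep_factor) * ennreal (noise_tail j a (Q / r))"
      using sep_factor_nonneg by (intro ennreal_mult tail_nonneg) simp
    also have "ennreal (noise_tail j a (Q / r)) = (\<Sum>l\<in>noise_comps S j. ennreal (noise_weight S j l) *
        ennreal (gaussian_Q (dmin (Q / r) / 2 * cmod a / sqrt (noise_var S j l))))"
      by (intro ennreal_sum_mult noise_weight_nonneg gaussian_Q_nonneg)
    finally show "ennreal (2 * sep_factor * noise_tail j a (Q / r)) = ennreal (2 * sep_factor) *
        (\<Sum>l\<in>noise_comps S j. ennreal (noise_weight S j l) * ennreal (gaussian_Q (k l * sqrt ((cmod a)\<^sup>2))))"
      by (simp add: k_def)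
  qed
  also have "\<dots> = ennreal (2 * sep_factor) * (\<Sum>l\<in>noise_comps S j. ennreal (noise_weight S j l) *
      (\<integral>\<^sup>+a. ennreal (gaussian_Q (k l * sqrt ((cmod a)\<^sup>2))) \<partial>law_h))"
    by (simp add: nn_integral_cmult nn_integral_sum)
  also have "\<dots> = ennreal (2 * sep_factor) * (\<Sum>l\<in>noise_comps S j. ennreal (noise_weight S j l) *
      ennreal ((1 - sqrt (sep_psi Q j l / (r + sep_psi Q j l))) / 2))"
  proof (intro arg_cong2[where f="(*)"] sum.cong refl)
    fix l assume l: "l \<in> noise_comps S j"
    have "(\<integral>\<^sup>+a. ennreal (gaussian_Q (k l * sqrt ((cmod a)\<^sup>2))) \<partial>law_h) =
        (\<integral>\<^sup>+x. ennreal (exponential_density 1 x) * ennreal (gaussian_Q (k l * sqrt x)) \<partial>lborel)"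
      by (rule distributed_distr_nn_integral[where X="fading_h S" and q="\<lambda>a. (cmod a)\<^sup>2", OF _ _ H, where \<phi>="\<lambda>x. ennreal (gaussian_Q (k l * sqrt x))"]) measurable
    then show "(\<integral>\<^sup>+a. ennreal (gaussian_Q (k l * sqrt ((cmod a)\<^sup>2))) \<partial>law_h) =
        ennreal ((1 - sqrt (sep_psi Q j l / (r + sep_psi Q j l))) / 2)"
      by (simp only: exponential_average_gaussian_Q[OF k[OF l]] k_eq[OF l])
  qed
  also have "\<dots> = ennreal (2 * sep_factor) * ennreal (\<Sum>l\<in>noise_comps S j. noise_weight S j l *
      ((1 - sqrt (sep_psi Q j l / (r + sep_psi Q j l))) / 2))"
    using term_nonneg by (subst ennreal_sum_mult) (auto intro: noise_weight_nonneg)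
  also have "\<dots> = ennreal (2 * sep_factor * (\<Sum>l\<in>noise_comps S j. noise_weight S j l *
      ((1 - sqrt (sep_psi Q j l / (r + sep_psi Q j l))) / 2)))"
    using sep_factor_nonneg term_nonneg
    by (intro ennreal_mult[symmetric] sum_nonneg mult_nonneg_nonneg noise_weight_nonneg divide_nonneg_nonneg) auto
  also have "2 * sep_factor * (\<Sum>l\<in>noise_comps S j. noise_weight S j l *
      ((1 - sqrt (sep_psi Q j l / (r + sep_psi Q j l))) / 2)) =
      sep_factor * (\<Sum>l\<in>noise_comps S j. noise_weight S j l * (1 - sqrt (sep_psi Q j l / (r + sep_psi Q j l))))"
    by (simp flip: sum_divide_distrib)
  finally show ?thesis .
qed

lemma average_capped:
  assumes G: "distributed (prob_of S) lborel (\<lambda>\<omega>. (cmod (fading_g S \<omega>))\<^sup>2) (\<lambda>x. ennreal (exponential_density 1 x))"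
    and Q: "0 < Q" and \<theta>: "0 \<le> \<theta>"
  shows "(\<integral>\<^sup>+b. indicator {\<theta><..} ((cmod b)\<^sup>2) * ennreal (sep_factor * (\<Sum>l\<in>noise_comps S j. noise_weight S j l *
      (1 - sqrt (sep_psi Q j l / ((cmod b)\<^sup>2 + sep_psi Q j l))))) \<partial>law_g) =
    ennreal (sep_factor * (\<Sum>l\<in>noise_comps S j. noise_weight S j l * sep_bracket \<theta> (sep_psi Q j l)))"
proof -
  let ?t = "\<lambda>l x. 1 - sqrt (sep_psi Q j l / (x + sep_psi Q j l))"
  have t: "0 \<le> ?t l x" if "l \<in> noise_comps S j" "0 \<le> x" for l x
    by (intro one_minus_sqrt_fraction_nonneg sep_psi_pos[OF Q that(1)] that(2))
  have "(\<integral>\<^sup>+b. indicator {\<theta><..} ((cmod b)\<^sup>2) * ennreal (sep_factor * (\<Sum>l\<in>noise_comps S j. noise_weight S j l * ?t l ((cmod b)\<^sup>2))) \<partial>law_g) =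
      (\<integral>\<^sup>+x. ennreal (exponential_density 1 x) * (indicator {\<theta><..} x *
        ennreal (sep_factor * (\<Sum>l\<in>noise_comps S j. noise_weight S j l * ?t l x))) \<partial>lborel)"
    by (rule distributed_distr_nn_integral[where X="fading_g S" and q="\<lambda>a. (cmod a)\<^sup>2", OF _ _ G, where \<phi>="\<lambda>x. indicator {\<theta><..} x *
        ennreal (sep_factor * (\<Sum>l\<in>noise_comps S j. noise_weight S j l * ?t l x))"]) measurable
  also have "\<dots> = (\<integral>\<^sup>+x. ennreal sep_factor * (\<Sum>l\<in>noise_comps S j. ennreal (noise_weight S j l) *
      (ennreal (exponential_density 1 x) * (indicator {\<theta><..} x * ennreal (?t l x)))) \<partial>lborel)"
  proof (rule nn_integral_cong)
    fix x
    show "ennreal (exponential_density 1 x) * (indicator {\<theta><..} x *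
        ennreal (sep_factor * (\<Sum>l\<in>noise_comps S j. noise_weight S j l * ?t l x))) =
      ennreal sep_factor * (\<Sum>l\<in>noise_comps S j. ennreal (noise_weight S j l) *
        (ennreal (exponential_density 1 x) * (indicator {\<theta><..} x * ennreal (?t l x))))"
    \<comment> \<open>Beyond \<theta> the argument is nonnegative, hence so is every term, which
      allows splitting the \<open>ennreal\<close> of the sum; elsewhere the indicator makes both
      sides 0.\<close>
    proof (cases "\<theta> < x")
      case True
      then have x: "0 \<le> x" using \<theta> by simp
      have "ennreal (sep_factor * (\<Sum>l\<in>noise_comps S j. noise_weight S j l * ?t l x)) =
          ennreal sep_factor * (\<Sum>l\<in>noise_comps S j. ennreal (noise_weight S j l) * ennreal (?t l x))"
        by (subst ennreal_mult, rule sep_factor_nonneg, intro sum_nonneg mult_nonneg_nonneg noise_weight_nonneg t x, assumption+)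
           (simp only: ennreal_sum_mult[OF noise_weight_nonneg t[OF _ x]])
      then show ?thesis
        using True by (simp add: sum_distrib_left ac_simps)
    qed simp
  qed
  also have "\<dots> = ennreal sep_factor * (\<Sum>l\<in>noise_comps S j. ennreal (noise_weight S j l) * ennreal (sep_bracket \<theta> (sep_psi Q j l)))"
    by (simp add: nn_integral_cmult nn_integral_sum sep_bracket_def exponential_tail_integral(1)[OF sep_psi_pos[OF Q] \<theta>])
  also have "\<dots> = ennreal sep_factor * ennreal (\<Sum>l\<in>noise_comps S j. noise_weight S j l * sep_bracket \<theta> (sep_psi Q j l))"
    using exponential_tail_integral(2)[OF sep_psi_pos[OF Q] \<theta>]
    by (subst ennreal_sum_mult) (auto simp: sep_bracket_def intro: noise_weight_nonneg)
  also have "\<dots> = ennreal (sep_factor * (\<Sum>l\<in>noise_comps S j. noise_weight S j l * sep_bracket \<theta> (sep_psi Q j l)))"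
    using exponential_tail_integral(2)[OF sep_psi_pos[OF Q] \<theta>]
    by (intro ennreal_mult[symmetric] sep_factor_nonneg sum_nonneg mult_nonneg_nonneg noise_weight_nonneg)
       (auto simp: sep_bracket_def)
  finally show ?thesis .
qed

text \<open>Where the peak power is reached, the error is not estimated but identified with that of
  the fixed-power system, whose detector has the same kernel. The bound enters only beyond
  \<open>Q / P\<close>, which is why tightness there gives equality overall.\<close>

lemma sep_given_idle_state:
  assumes j: "idle_state_possible S j" and P: "0 < P" and Q: "0 < Q"
    and H: "distributed (prob_of S) lborel (\<lambda>\<omega>. (cmod (fading_h S \<omega>))\<^sup>2) (\<lambda>x. ennreal (exponential_density 1 x))"
    and G: "distributed (prob_of S) lborel (\<lambda>\<omega>. (cmod (fading_g S \<omega>))\<^sup>2) (\<lambda>x. ennreal (exponential_density 1 x))"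
    and det: "MAP_detector S (limited_power S P Q) detect" and det_pk: "MAP_detector S (\<lambda>_. P) detect_pk"
  defines "bound \<equiv> (1 - exp (- (Q / P))) * measure (given_idle_state S j) (symbol_error (\<lambda>_. P) detect_pk) +
      sep_factor * (\<Sum>l\<in>noise_comps S j. noise_weight S j l * sep_bracket (Q / P) (sep_psi Q j l))"
  shows "measure (given_idle_state S j) (symbol_error (limited_power S P Q) detect) \<le> bound"
    and "size_Q S = 1 \<Longrightarrow> measure (given_idle_state S j) (symbol_error (limited_power S P Q) detect) = bound"
proof -
  let ?K = "given_idle_state S j" and ?\<theta> = "Q / P"
  interpret K: prob_space ?K by (rule prob_space_given_idle[OF j])
  interpret G: prob_space law_g by (rule prob_space_laws)
  have \<theta>: "0 \<le> ?\<theta>" using P Q by simp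
  note h0 = law_h_nonzero[OF H]
  let ?e = "emeasure ?K (symbol_error (limited_power S P Q) detect)"
  let ?pk = "emeasure ?K (symbol_error (\<lambda>_. P) detect_pk)"
  let ?R = "\<lambda>r. ennreal (sep_factor * (\<Sum>l\<in>noise_comps S j. noise_weight S j l * (1 - sqrt (sep_psi Q j l / (r + sep_psi Q j l)))))"
  let ?B = "sep_factor * (\<Sum>l\<in>noise_comps S j. noise_weight S j l * sep_bracket ?\<theta> (sep_psi Q j l))"
  let ?rhs = "\<lambda>b. indicator {..?\<theta>} ((cmod b)\<^sup>2) * ?pk + indicator {?\<theta><..} ((cmod b)\<^sup>2) * ?R ((cmod b)\<^sup>2)"
  have e: "?e = (\<integral>\<^sup>+b. \<integral>\<^sup>+a. err_kernel j a (power_cap P Q b) \<partial>law_h \<partial>law_g)"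
    using det unfolding limited_power_eq
    by (intro symbol_error_given_idle[OF j power_cap_measurable power_cap_pos[OF P Q] _ h0])
  \<comment> \<open>At fixed power the kernel does not depend on \<open>g\<close>, so the outer
    average is over a constant.\<close>
  have pk: "?pk = (\<integral>\<^sup>+a. err_kernel j a P \<partial>law_h)"
    using symbol_error_given_idle[OF j borel_measurable_const P det_pk h0]
    by (simp add: G.emeasure_space_1[simplified])
  have le: "(\<integral>\<^sup>+a. err_kernel j a (power_cap P Q b) \<partial>law_h) \<le> ?rhs b"
    and eq: "size_Q S = 1 \<Longrightarrow> (\<integral>\<^sup>+a. err_kernel j a (power_cap P Q b) \<partial>law_h) = ?rhs b" for b
  proof -
    have "(\<integral>\<^sup>+a. err_kernel j a (power_cap P Q b) \<partial>law_h) \<le> ?rhs b \<and>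
      (size_Q S = 1 \<longrightarrow> (\<integral>\<^sup>+a. err_kernel j a (power_cap P Q b) \<partial>law_h) = ?rhs b)"
    proof (cases "(cmod b)\<^sup>2 \<le> ?\<theta>")
      case True
      then have "?rhs b = ?pk" by simp
      then show ?thesis
        by (simp only: power_cap_eq(1)[OF P Q True] pk order_refl simp_thms)
    next
      case False
      then have b: "?\<theta> < (cmod b)\<^sup>2" by simp
      with \<theta> have r: "0 < (cmod b)\<^sup>2" by linarith
      have x: "0 < Q / (cmod b)\<^sup>2" using Q r by simp
      have "?rhs b = ?R ((cmod b)\<^sup>2)" using b by simp
      then have rhs: "?rhs b = (\<integral>\<^sup>+a. ennreal (2 * sep_factor * noise_tail j a (Q / (cmod b)\<^sup>2)) \<partial>law_h)"
        by (simp only: average_noise_tail[OF H Q r])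
      show ?thesis
        unfolding rhs power_cap_eq(2)[OF P Q b]
      proof (intro conjI impI nn_integral_mono_AE nn_integral_cong_AE)
        show "AE a in law_h. err_kernel j a (Q / (cmod b)\<^sup>2) \<le> ennreal (2 * sep_factor * noise_tail j a (Q / (cmod b)\<^sup>2))"
          using h0 by eventually_elim (rule kernel_bound(1)[OF _ x])
        show "AE a in law_h. err_kernel j a (Q / (cmod b)\<^sup>2) = ennreal (2 * sep_factor * noise_tail j a (Q / (cmod b)\<^sup>2))"
          if "size_Q S = 1"
          using h0 by eventually_elim (rule kernel_bound(2)[OF _ x that])
      qed
    qed
    then show "(\<integral>\<^sup>+a. err_kernel j a (power_cap P Q b) \<partial>law_h) \<le> ?rhs b"
      "size_Q S = 1 \<Longrightarrow> (\<integral>\<^sup>+a. err_kernel j a (power_cap P Q b) \<partial>law_h) = ?rhs b"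
      by simp_all
  qed
  have low: "(\<integral>\<^sup>+b. indicator {..?\<theta>} ((cmod b)\<^sup>2) \<partial>law_g) = ennreal (1 - exp (- ?\<theta>))"
    using distributed_distr_nn_integral[where X="fading_g S" and q="\<lambda>a. (cmod a)\<^sup>2", OF _ _ G, where \<phi>="indicator {..?\<theta>}"] nn_integral_exponential_Icc[OF \<theta>]
    by simp
  have B: "0 \<le> ?B"
    using exponential_tail_integral(2)[OF sep_psi_pos[OF Q] \<theta>]
    by (intro sep_factor_nonneg sum_nonneg mult_nonneg_nonneg noise_weight_nonneg) (auto simp: sep_bracket_def)
  have c: "0 \<le> 1 - exp (- ?\<theta>)"
    using \<theta> by simp
  have "(\<integral>\<^sup>+b. ?rhs b \<partial>law_g) = ennreal (1 - exp (- ?\<theta>)) * ?pk + ennreal ?B"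
    by (subst nn_integral_add) (simp_all add: nn_integral_multc low average_capped[OF G Q \<theta>])
  also have "\<dots> = ennreal bound"
    unfolding bound_def K.emeasure_eq_measure
    by (simp only: ennreal_plus[OF mult_nonneg_nonneg[OF c measure_nonneg] B] ennreal_mult[OF c measure_nonneg])
  finally have rhs: "(\<integral>\<^sup>+b. ?rhs b \<partial>law_g) = ennreal bound" .
  have bound: "0 \<le> bound"
    unfolding bound_def by (intro add_nonneg_nonneg[OF mult_nonneg_nonneg[OF c measure_nonneg] B])
  have "?e \<le> ennreal bound"
    unfolding e rhs[symmetric] by (intro nn_integral_mono le)
  then show "measure ?K (symbol_error (limited_power S P Q) detect) \<le> bound"
    using bound by (simp add: K.emeasure_eq_measure)
  assume "size_Q S = 1"
  then have "?e = ennreal bound"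
    unfolding e rhs[symmetric] by (intro nn_integral_cong eq)
  then show "measure ?K (symbol_error (limited_power S P Q) detect) = bound"
    using bound by (simp add: K.emeasure_eq_measure)
qed

text \<open>The law of total probability given an idle decision. For an impossible state the
  conditional measure is degenerate, but both its posterior and its share of the error event are
  0.\<close>

lemma symbol_error_prob_eq:
  assumes [measurable]: "P \<in> borel_measurable (prob_of S)" and det: "MAP_detector S P detect"
  shows "symbol_error_prob S P detect =
    posterior S False * measure (given_idle_state S False) (symbol_error P detect) +
    posterior S True * measure (given_idle_state S True) (symbol_error P detect)"
proof -
  let ?E = "symbol_error P detect" and ?M = "prob_of S"
  let ?idle = "{\<omega> \<in> space ?M. \<not> busy S \<omega>}"
  have E[measurable]: "?E \<in> sets ?M"
    using det by (intro sets_symbol_error) (simp_all add: MAP_detector_def)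
  have part: "prob (?E \<inter> idle_event S j) / prob ?idle = posterior S j * measure (given_idle_state S j) ?E" for j
  proof (cases "idle_state_possible S j")
    case True
    then have pos: "0 < prob (idle_event S j)"
      by (simp add: idle_state_possible_def)
    have "measure (given_idle_state S j) ?E = prob (idle_event S j \<inter> ?E) / prob (idle_event S j)"
      using pos unfolding given_idle_state_def by (intro measure_uniform_measure) (auto simp: emeasure_eq_measure)
    then show ?thesis
      using pos by (simp add: posterior_def cond_prob_def conj_commute Int_commute)
  next
    case False
    then have "prob (idle_event S j) = 0"
      using measure_nonneg[of ?M "idle_event S j"] by (simp add: idle_state_possible_def)
    moreover have "prob (?E \<inter> idle_event S j) \<le> prob (idle_event S j)"
      by (intro finite_measure_mono) auto
    ultimately have "prob (?E \<inter> idle_event S j) = 0"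
      using measure_nonneg[of ?M "?E \<inter> idle_event S j"] by simp
    then show ?thesis
      using posterior_impossible[OF False] by simp
  qed
  have eq: "{\<omega> \<in> space ?M. detect (fading_h S \<omega>) (P \<omega>) (rx_signal S P \<omega>) \<noteq> tx_symbol S P \<omega> \<and> \<not> busy S \<omega>} =
      (?E \<inter> idle_event S False) \<union> (?E \<inter> idle_event S True)"
    by (auto simp: symbol_error_def)
  have "prob ((?E \<inter> idle_event S False) \<union> (?E \<inter> idle_event S True)) =
      prob (?E \<inter> idle_event S False) + prob (?E \<inter> idle_event S True)"
    by (rule finite_measure_Union) auto
  then show ?thesis
    unfolding symbol_error_prob_def cond_prob_def eq by (simp only: add_divide_distrib part)
qed

end

theorem mainTheorem6:
  fixes S :: "'a osa_system" and P_pk Q_pk :: real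
    and detect detect_pk :: "complex \<Rightarrow> real \<Rightarrow> complex \<Rightarrow> complex"
  assumes "osa_model S"
    and "0 < P_pk" and "0 < Q_pk"
    and "distributed (prob_of S) lborel (\<lambda>\<omega>. (cmod (fading_h S \<omega>))\<^sup>2)
           (\<lambda>x. ennreal (exponential_density 1 x))"
    and "distributed (prob_of S) lborel (\<lambda>\<omega>. (cmod (fading_g S \<omega>))\<^sup>2)
           (\<lambda>x. ennreal (exponential_density 1 x))"
    and "MAP_detector S (limited_power S P_pk Q_pk) detect"
    and "MAP_detector S (\<lambda>_. P_pk) detect_pk"
  shows "let M_I = real (size_I S);
             M_Q = real (size_Q S);
             SEP = symbol_error_prob S (limited_power S P_pk Q_pk) detect;
             SEP_pk = symbol_error_prob S (\<lambda>_. P_pk) detect_pk;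
             \<psi>\<^sub>0 = 3 * Q_pk / (2 * (M_I\<^sup>2 + M_Q\<^sup>2 - 2) * (sigma_noise S)\<^sup>2);
             \<psi>\<^sub>1 = (\<lambda>l. 3 * Q_pk / (2 * (M_I\<^sup>2 + M_Q\<^sup>2 - 2) * ((mix_sigma S l)\<^sup>2 + (sigma_noise S)\<^sup>2)));
             bracket = (\<lambda>\<psi>. exp (- (Q_pk / P_pk)) -
               2 * sqrt (\<psi> * pi) * exp \<psi> * gaussian_Q (sqrt (2 * (Q_pk / P_pk + \<psi>))));
             bound = (1 - exp (- (Q_pk / P_pk))) * SEP_pk +
               (2 - 1 / M_I - 1 / M_Q) *
                 (posterior S False * bracket \<psi>\<^sub>0 +
                  posterior S True * (\<Sum>l=1..mix_number S. mix_weight S l * bracket (\<psi>\<^sub>1 l)))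
         in SEP \<le> bound \<and> (size_Q S = 1 \<longrightarrow> SEP = bound)"
proof -
  interpret osa_model S by fact
  let ?p = "\<lambda>j. measure (given_idle_state S j) (symbol_error (limited_power S P_pk Q_pk) detect)"
  let ?pk = "\<lambda>j. measure (given_idle_state S j) (symbol_error (\<lambda>_. P_pk) detect_pk)"
  let ?B = "\<lambda>j. \<Sum>l\<in>noise_comps S j. noise_weight S j l * sep_bracket (Q_pk / P_pk) (sep_psi Q_pk j l)"
  let ?b = "\<lambda>j. (1 - exp (- (Q_pk / P_pk))) * ?pk j + sep_factor * ?B j"
  have SEP: "symbol_error_prob S (limited_power S P_pk Q_pk) detect = posterior S False * ?p False + posterior S True * ?p True"
    using assms(6) by (intro symbol_error_prob_eq) (simp_all add: limited_power_eq)
  have SEP_pk: "symbol_error_prob S (\<lambda>_. P_pk) detect_pk = posterior S False * ?pk False + posterior S True * ?pk True"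
    using assms(7) by (intro symbol_error_prob_eq) simp_all
  \<comment> \<open>The posterior is kept as a factor because the bound for a single state is
    available only if that state is possible.\<close>
  have le: "posterior S j * ?p j \<le> posterior S j * ?b j" for j
  proof (cases "idle_state_possible S j")
    case True
    from sep_given_idle_state(1)[OF True assms(2-7)] show ?thesis
      by (intro mult_left_mono posterior_nonneg)
  qed (simp add: posterior_impossible)
  have eq: "posterior S j * ?p j = posterior S j * ?b j" if "size_Q S = 1" for j
  proof (cases "idle_state_possible S j")
    case True
    from sep_given_idle_state(2)[OF True assms(2-7) that] show ?thesis
      by (rule arg_cong)
  qed (simp add: posterior_impossible)
  \<comment> \<open>The bound is affine in the fixed-power error probability with coefficients
    common to both states, so averaging over the posteriors reassembles it.\<close>
  have total: "(1 - exp (- (Q_pk / P_pk))) * symbol_error_prob S (\<lambda>_. P_pk) detect_pk +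
      sep_factor * (posterior S False * ?B False + posterior S True * ?B True) =
      posterior S False * ?b False + posterior S True * ?b True"
    unfolding SEP_pk by (simp only: algebra_simps)
  have "symbol_error_prob S (limited_power S P_pk Q_pk) detect \<le> (1 - exp (- (Q_pk / P_pk))) * symbol_error_prob S (\<lambda>_. P_pk) detect_pk +
      sep_factor * (posterior S False * ?B False + posterior S True * ?B True)"
    unfolding total SEP by (intro add_mono le)
  moreover have "symbol_error_prob S (limited_power S P_pk Q_pk) detect = (1 - exp (- (Q_pk / P_pk))) * symbol_error_prob S (\<lambda>_. P_pk) detect_pk +
      sep_factor * (posterior S False * ?B False + posterior S True * ?B True)" if "size_Q S = 1"
    unfolding total SEP using eq[OF that] by (intro arg_cong2[where f="(+)"])
  ultimately show ?thesis
    \<comment> \<open>For the idle state the sum over components collapses to the single index 0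
      with weight 1, which yields the bracket at \<open>\<psi>\<^sub>0\<close>.\<close>
    unfolding Let_def noise_comps_def noise_weight_def noise_var_def sep_bracket_def sep_psi_def by simp
qed

end
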